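(* Let $D\subseteq\mathbb R$ be a nonempty open interval, let $m\ge 2$ be an integer, and let $x^*\in D$. Let $J\in C^m(D;\mathbb R)$, put $J^*=J(x^* )$, and suppose there are constants $\alpha_1,\alpha_2,\beta_1,\beta_2>0$ such that for all $x\in D$ $$\alpha_1|x-x^*|^m\le J(x)-J^*\le\alpha_2|x-x^*|^m,$$ $$J^{(m-1)}(x)(x-x^* )\ge\beta_1|x-x^*|^2,\qquad |J^{(m-1)}(x)|\le\beta_2|x-x^*|.$$ Let $g_1,\dots,g_m:\mathbb R\to\mathbb R$ be such that $G_k:=g_k\circ J\in C^m(D;\mathbb R)$ for $k=1,\dots,m$ and, for some multi-index $I_m=(i_1,\dots,i_m)\in\{1,\dots,m\}^m$ and some constant $c_m>0$, the right-iterated Lie bracket $$G_{I_m}:=\big[\cdots\big[[G_{i_1},G_{i_2}],G_{i_3}\big],\dots,G_{i_m}\big]$$ satisfies $G_{I_m}(x)=-c_mJ^{(m-1)}(x)$ for all $x\in D$. For $\varepsilon>0$ let $u_k^\varepsilon(t)=\varepsilon^{\frac1m-1}v_k(t/\varepsilon)$, $k=1,\dots,m$, where $v_1,\dots,v_m:\mathbb R\to\mathbb R$ are $1$-periodic, measurable, essentially bounded functions not depending on $\varepsilon$ (so that the $u_k^\varepsilon$ are $\varepsilon$-periodic), and suppose that these dithers excite exactly the Lie bracket $G_{I_m}$ at time $t=\varepsilon$, i.e. for all $\varepsilon>0$ and all $x^0\in D$ $$\sum_{\ell=1}^m\ \sum_{k_1,\dots,k_\ell=1}^{m}\big(L_{G_{k_\ell}}\cdots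 L_{G_{k_2}}G_{k_1}\big)(x^0)\int_0^\varepsilon\!\int_0^{s_1}\!\!\cdots\!\int_0^{s_{\ell-1}}u_{k_1}^\varepsilon(s_1)\cdots u_{k_\ell}^\varepsilon(s_\ell)\,ds_\ell\cdots ds_1=\varepsilon\,G_{I_m}(x^0).$$ Then the point $x^*$ is semi-globally practically exponentially stable for the extremum seeking system $$\dot x=\sum_{k=1}^m g_k(J(x))\,u_k^\varepsilon(t).$$
   Context: For scalar functions $f,g$ on $D\subseteq\mathbb R$, the Lie derivative of $f$ along $g$ is $L_gf(x)=\lim_{s\to0}\frac{f(x+sg(x))-f(x)}{s}=f'(x)g(x)$, and the Lie bracket is $[f,g](x)=L_fg(x)-L_gf(x)$. For $\ell=1$ the expression $L_{G_{k_\ell}}\cdots L_{G_{k_2}}G_{k_1}$ means $G_{k_1}$. $J^{(\ell)}$ is the $\ell$-th derivative. The left-hand side of the last hypothesis is the Chen--Fliess expansion of $x(\varepsilon)-x^0$ truncated at order $m$; the hypothesis says that $x(\varepsilon)=x^0+\varepsilon\,G_{I_m}(x^0)+R(\varepsilon)$ with $R$ the Chen--Fliess remainder. Solutions are Carathéodory solutions with $x(0)=x^0$. Semi-global practical exponential stability of $x^*$ (relative to the domain $D$ on which the hypotheses hold): for every $\delta>0$ with $\overline{B_\delta(x^* )}\subset D$ (where $B_\delta(x^* )=\{x:|x-x^*|<\delta\}$) there exist $c>0$ and $\lambda>0$ such that for every $\rho\in(0,\delta)$ there exists $\bar\varepsilon>0$ such that for every $\varepsilon\in(0,\bar\varepsilon]$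 and every $x^0\in B_\delta(x^* )$ the solution $x(t)$ with $x(0)=x^0$ is defined in $D$ for all $t\ge0$ and satisfies $$|x(t)-x^*|\le c\,|x^0-x^*|\,e^{-\lambda t}+\rho\quad\text{for all }t\ge0.$$ *)

theory Defs
  imports "HOL-Analysis.Analysis"
begin

text \<open>
  Functions on the open set \<open>D\<close> are represented by total functions on the reals; every notion below,
  evaluated at a point of \<open>D\<close>, depends only on the values on \<open>D\<close>.
\<close>

definition Cn_on :: "nat \<Rightarrow> real set \<Rightarrow> (real \<Rightarrow> real) \<Rightarrow> bool" where
  "Cn_on n D f \<longleftrightarrow>
     (\<forall>j<n. \<forall>x\<in>D. (deriv ^^ j) f field_differentiable at x) \<and> continuous_on D ((deriv ^^ n) f)"

text \<open>\<open>lie_deriv g f\<close> is the derivative of \<open>f\<close> along \<open>g\<close>.\<close>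

definition lie_deriv :: "(real \<Rightarrow> real) \<Rightarrow> (real \<Rightarrow> real) \<Rightarrow> real \<Rightarrow> real" where
  "lie_deriv g f x = Lim (at 0) (\<lambda>s. (f (x + s * g x) - f x) / s)"

definition lie_bracket :: "(real \<Rightarrow> real) \<Rightarrow> (real \<Rightarrow> real) \<Rightarrow> real \<Rightarrow> real" where
  "lie_bracket f g x = lie_deriv f g x - lie_deriv g f x"

lemma lie_deriv_eq:
  assumes "f field_differentiable at x"
  shows "lie_deriv g f x = deriv f x * g x"
proof -
  have "(f has_real_derivative deriv f x) (at x)"
    using assms by (simp add: DERIV_deriv_iff_field_differentiable)
  then have *: "(f has_real_derivative deriv f x) (at (x + 0 * g x))"
    by simp
  have "((\<lambda>s. x + s * g x) has_real_derivative g x) (at 0)"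
    by (auto intro!: derivative_eq_intros)
  with * have "((\<lambda>s. f (x + s * g x)) has_real_derivative deriv f x * g x) (at 0)"
    by (rule DERIV_chain2)
  then have "((\<lambda>s. (f (x + s * g x) - f x) / s) \<longlongrightarrow> deriv f x * g x) (at 0)"
    by (simp add: DERIV_def)
  then show ?thesis
    unfolding lie_deriv_def by (intro tendsto_Lim) simp_all
qed

text \<open>
  For a nonempty multi-index \<open>[k\<^sub>1, \<dots>, k\<^sub>l]\<close>: the iterated Lie derivative, in which \<open>G k\<^sub>1\<close> is
  differentiated first along \<open>G k\<^sub>2\<close> and last along \<open>G k\<^sub>l\<close>, and the bracket
  \<open>[\<dots>[[G k\<^sub>1, G k\<^sub>2], G k\<^sub>3], \<dots>, G k\<^sub>l]\<close>.
\<close>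

definition iterated_lie_deriv :: "(nat \<Rightarrow> real \<Rightarrow> real) \<Rightarrow> nat list \<Rightarrow> real \<Rightarrow> real" where
  "iterated_lie_deriv G ks = foldl (\<lambda>f k. lie_deriv (G k) f) (G (hd ks)) (tl ks)"

definition iterated_lie_bracket :: "(nat \<Rightarrow> real \<Rightarrow> real) \<Rightarrow> nat list \<Rightarrow> real \<Rightarrow> real" where
  "iterated_lie_bracket G ks = foldl (\<lambda>f k. lie_bracket f (G k)) (G (hd ks)) (tl ks)"

text \<open>
  For \<open>[k\<^sub>1, \<dots>, k\<^sub>l]\<close>, the iterated integral of \<open>u k\<^sub>1 s\<^sub>1 * \<dots> * u k\<^sub>l s\<^sub>l\<close> over
  \<open>0 \<le> s\<^sub>l \<le> \<dots> \<le> s\<^sub>1 \<le> t\<close>; the head of the list belongs to the outermost integral.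
\<close>

fun iterated_integral :: "(nat \<Rightarrow> real \<Rightarrow> real) \<Rightarrow> nat list \<Rightarrow> real \<Rightarrow> real" where
  "iterated_integral u [] t = 1"
| "iterated_integral u (k # ks) t = (LINT s:{0..t}|lebesgue. u k s * iterated_integral u ks s)"

definition chen_fliess_sum ::
    "nat \<Rightarrow> (nat \<Rightarrow> real \<Rightarrow> real) \<Rightarrow> (nat \<Rightarrow> real \<Rightarrow> real) \<Rightarrow> real \<Rightarrow> real \<Rightarrow> real" where
  "chen_fliess_sum m G u x t =
     (\<Sum>l=1..m. \<Sum>ks\<in>{ks. set ks \<subseteq> {1..m} \<and> length ks = l}.
        iterated_lie_deriv G ks x * iterated_integral u ks t)"

definition dither :: "nat \<Rightarrow> (nat \<Rightarrow> real \<Rightarrow> real) \<Rightarrow> real \<Rightarrow> nat \<Rightarrow> real \<Rightarrow> real" where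
  "dither m v \<epsilon> k t = \<epsilon> powr (1 / real m - 1) * v k (t / \<epsilon>)"

text \<open>
  Absolute continuity on the compact interval \<open>{a..b}\<close>. The members of a division are finitely many
  compact intervals with disjoint interiors; the union \<open>S\<close> need not be all of \<open>{a..b}\<close>.
\<close>

definition absolutely_continuous_Icc :: "real \<Rightarrow> real \<Rightarrow> (real \<Rightarrow> real) \<Rightarrow> bool" where
  "absolutely_continuous_Icc a b f \<longleftrightarrow>
     (\<forall>e>0. \<exists>d>0. \<forall>\<D> S. \<D> division_of S \<and> S \<subseteq> {a..b} \<and> (\<Sum>K\<in>\<D>. Sup K - Inf K) < d
        \<longrightarrow> (\<Sum>K\<in>\<D>. \<bar>f (Sup K) - f (Inf K)\<bar>) < e)"

text \<open>Caratheodory solutions on the interval \<open>I\<close>, with values in \<open>D\<close>, of \<open>x' = F t x\<close>.\<close>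

definition caratheodory_solution ::
    "(real \<Rightarrow> real \<Rightarrow> real) \<Rightarrow> real set \<Rightarrow> real set \<Rightarrow> (real \<Rightarrow> real) \<Rightarrow> bool" where
  "caratheodory_solution F D I x \<longleftrightarrow>
     (\<forall>t\<in>I. x t \<in> D) \<and>
     (\<forall>a b. {a..b} \<subseteq> I \<longrightarrow> absolutely_continuous_Icc a b x) \<and>
     (AE t in lebesgue. t \<in> I \<longrightarrow> (x has_real_derivative F t (x t)) (at t within I))"

text \<open>
  The existential quantifier over \<open>x\<close> and the clause on \<open>y\<close> together say that \<open>x\<close> is \<^emph>\<open>the\<close> solution with
  initial value \<open>x0\<close>: it exists in \<open>D\<close> for all \<open>t \<ge> 0\<close>, and every other solution, defined possibly on
  a shorter time interval only, coincides with it there.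
\<close>

definition semiglobally_practically_exp_stable ::
    "(real \<Rightarrow> real \<Rightarrow> real \<Rightarrow> real) \<Rightarrow> real set \<Rightarrow> real \<Rightarrow> bool" where
  "semiglobally_practically_exp_stable F D xs \<longleftrightarrow>
     (\<forall>\<delta>>0. closure (ball xs \<delta>) \<subseteq> D \<longrightarrow>
       (\<exists>c>0. \<exists>r>0. \<forall>\<rho>\<in>{0<..<\<delta>}. \<exists>\<epsilon>'>0. \<forall>\<epsilon>\<in>{0<..\<epsilon>'}. \<forall>x0\<in>ball xs \<delta>.
          \<exists>x. caratheodory_solution (F \<epsilon>) D {0..} x \<and> x 0 = x0 \<and>
              (\<forall>T y. caratheodory_solution (F \<epsilon>) D {0..<T} y \<and> y 0 = x0 \<longrightarrow> (\<forall>t\<in>{0..<T}. y t = x t)) \<and>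
              (\<forall>t\<ge>0. \<bar>x t - xs\<bar> \<le> c * \<bar>x0 - xs\<bar> * exp (- r * t) + \<rho>)))"

end

theory Submission
  imports Defs
begin

text \<open>
  Over one period \<open>\<epsilon>\<close> the Chen-Fliess expansion turns the excitation hypothesis into
  \<open>x (t + \<epsilon>) = x t - \<epsilon> c J\<^sup>(\<^sup>m\<^sup>-\<^sup>1\<^sup>) (x t) + R\<close> with \<open>R = O (\<epsilon> \<kappa>)\<close>, where \<open>\<kappa> = \<epsilon> powr (1 / m)\<close>: each iterated
  integral of length \<open>m + 1\<close> is at most \<open>(\<epsilon> powr (1 / m - 1) * V * \<epsilon>) ^ (m + 1) = V ^ (m + 1) * \<kappa> * \<epsilon>\<close>. The bounds on
  the derivative of order \<open>m - 1\<close> make the unperturbed step a contraction towards \<open>xs\<close> with factor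
  \<open>1 - \<epsilon> c \<beta>1\<close>, so \<open>\<bar>x (n \<epsilon>) - xs\<bar>\<close> decays geometrically up to an error \<open>O (\<kappa>)\<close>. Between
  multiples of the period the state moves by \<open>O (\<kappa>)\<close> only. Global existence comes from Picard
  iteration for the vector fields composed with the projection onto a slightly larger interval,
  which the solution never leaves.
\<close>

section \<open>Absolutely continuous functions of one variable\<close>

text \<open>Two claims need each other: the one-period expansion holds only while the state stays in
  a compact interval \<open>{p..q}\<close> inside \<open>D\<close>, and staying there follows only
  from the contraction that the expansion yields. The clipped fields break the circle. Their
  solution exists for all times with a speed bounded in advance, so for small \<epsilon> a state
  within \<delta> of \<open>xs\<close> cannot leave \<open>{p..q}\<close> during one period; there
  the clipped and the original system agree, the expansion applies, and the next sample is again
  within \<delta>. The order of the expansion matches the smoothness. A word of length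
  \<open>m + 1\<close> carries \<open>m\<close> Lie derivatives of a function of class C^m, so it is
  still continuous and hence bounded on \<open>{p..q}\<close>, uniformly in \<epsilon>. The dithers
  are only measurable and essentially bounded. Trajectories are therefore handled through integral
  equations; derivatives almost everywhere occur only in the integrated chain rule and in passing to
  and from Caratheodory solutions.\<close>

text \<open>
  The gauge confines the intervals tagged in the exceptional set \<open>N\<close> to an open set of small measure,
  on which absolute continuity controls the variation; all other intervals obey the derivative bound.
\<close>

lemma absolutely_continuous_Icc_mean_value:
  fixes z w :: "real \<Rightarrow> real"
  assumes "a \<le> b" and ac: "absolutely_continuous_Icc a b z"
    and N: "negligible N"
    and der: "\<And>t. t \<in> {a..b} - N \<Longrightarrow> (z has_real_derivative w t) (at t within {a..b}) \<and> \<bar>w t\<bar> \<le> C"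
    and C: "C \<ge> 0"
  shows "\<bar>z b - z a\<bar> \<le> C * (b - a)"
proof (rule field_le_epsilon)
  fix e :: real assume "e > 0"
  \<comment> \<open>Error budget: \<eta> for the variation over intervals tagged in
    \<open>N\<close>, and \<eta> per unit of length for all others.\<close>
  define \<eta> where "\<eta> = e / (1 + (b - a))"
  have \<eta>: "\<eta> > 0" "\<eta> * (1 + (b - a)) = e"
    using \<open>e > 0\<close> \<open>a \<le> b\<close> by (auto simp: \<eta>_def)
  obtain d where "d > 0"
    and d: "\<And>\<D> S. \<D> division_of S \<Longrightarrow> S \<subseteq> {a..b} \<Longrightarrow> (\<Sum>K\<in>\<D>. Sup K - Inf K) < d
        \<Longrightarrow> (\<Sum>K\<in>\<D>. \<bar>z (Sup K) - z (Inf K)\<bar>) < \<eta>"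
    using ac \<eta>(1) unfolding absolutely_continuous_Icc_def by meson
  obtain U where U: "open U" "N \<subseteq> U" "U - N \<in> lmeasurable" "emeasure lebesgue (U - N) < ennreal d"
    using sets_lebesgue_outer_open[of N d] N \<open>d > 0\<close> negligible_iff_null_sets by blast
  have Ulm: "U \<in> lmeasurable" "measure lebesgue U < d"
  proof -
    have "U = (U - N) \<union> N" using U(2) by auto
    then show "U \<in> lmeasurable"
      by (metis N U(3) fmeasurable.Un negligible_imp_measurable)
    have "measure lebesgue U = measure lebesgue (U - N)"
      using N U(3) by (metis Diff_Diff_Int Int_commute measure_Diff_null_set negligible_iff_null_sets
           \<open>U \<in> lmeasurable\<close> fmeasurableD)
    also have "\<dots> < d"
      using U(4) U(3) \<open>d > 0\<close> by (metis emeasure_eq_measure2 ennreal_less_iff measure_nonneg)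
    finally show "measure lebesgue U < d" .
  qed
  have "\<exists>r>0. \<forall>s\<in>{a..b}. \<bar>s - t\<bar> < r \<longrightarrow> \<bar>z s - z t\<bar> \<le> (C + \<eta>) * \<bar>s - t\<bar>"
    if t: "t \<in> {a..b} - N" for t
  proof -
    from der[OF t] have dt: "(z has_derivative (\<lambda>h. w t * h)) (at t within {a..b})" and wt: "\<bar>w t\<bar> \<le> C"
      by (auto simp: has_field_derivative_def)
    have "\<exists>r>0. \<forall>s\<in>{a..b}. norm (s - t) < r \<longrightarrow>
        norm (z s - z t - w t * (s - t)) \<le> \<eta> * norm (s - t)"
      using dt \<eta>(1) unfolding has_derivative_within_alt by blast
    then obtain r where r: "r > 0" "\<And>s. s \<in> {a..b} \<Longrightarrow> \<bar>s - t\<bar> < r \<Longrightarrow>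
        \<bar>z s - z t - w t * (s - t)\<bar> \<le> \<eta> * \<bar>s - t\<bar>"
      by auto
    have "\<bar>z s - z t\<bar> \<le> (C + \<eta>) * \<bar>s - t\<bar>" if "s \<in> {a..b}" "\<bar>s - t\<bar> < r" for s
    proof -
      have "\<bar>z s - z t\<bar> \<le> \<bar>z s - z t - w t * (s - t)\<bar> + \<bar>w t * (s - t)\<bar>" by linarith
      also have "\<dots> \<le> \<eta> * \<bar>s - t\<bar> + C * \<bar>s - t\<bar>"
        using r(2)[OF that] wt by (auto simp: abs_mult intro!: add_mono mult_right_mono)
      finally show ?thesis by (simp add: algebra_simps)
    qed
    with r(1) show ?thesis by blast
  qed
  then obtain r where r: "\<And>t. t \<in> {a..b} - N \<Longrightarrow> r t > 0"
    "\<And>t s. t \<in> {a..b} - N \<Longrightarrow> s \<in> {a..b} \<Longrightarrow> \<bar>s - t\<bar> < r t \<Longrightarrow> \<bar>z s - z t\<bar> \<le> (C + \<eta>) * \<bar>s - t\<bar>"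
    by metis
  \<comment> \<open>The last branch is a default that only makes \<open>\<gamma>\<close> a gauge:
    tags lie in \<open>{a..b}\<close>.\<close>
  define \<gamma> where "\<gamma> t = (if t \<in> N then U else if t \<in> {a..b} then ball t (r t) else ball t 1)" for t
  have "gauge \<gamma>"
    using U r(1) by (auto simp: gauge_def \<gamma>_def)
  then obtain p where p: "p tagged_division_of {a..b}" "\<gamma> fine p"
    by (rule fine_division_exists_real)
  note pD = tagged_division_ofD[OF p(1)]
  define p1 where "p1 = {(t, K) \<in> p. t \<in> N}"
  define p2 where "p2 = {(t, K) \<in> p. t \<notin> N}"
  have pp: "p = p1 \<union> p2" "p1 \<inter> p2 = {}" "p1 \<subseteq> p" "p2 \<subseteq> p" "finite p1" "finite p2"
    using pD(1) by (auto simp: p1_def p2_def intro: finite_subset[OF _ pD(1)])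
  have p1U: "p1 tagged_division_of (\<Union>(snd ` p1))"
    using tagged_partial_division_of_Union_self tagged_partial_division_subset pp(3)
      p(1) tagged_division_of_def by metis
  have sub: "\<Union>(snd ` p1) \<subseteq> {a..b} \<inter> U"
    using pD(3) p(2) by (force simp: p1_def fine_def \<gamma>_def)
  have div: "(snd ` p1) division_of (\<Union>(snd ` p1))"
    by (rule division_of_tagged_division[OF p1U])
  have iv: "\<exists>u v. K = {u..v} \<and> u \<le> v" if "(t, K) \<in> p" for t K
    using pD(2,4)[OF that] by fastforce
  have sumK: "(\<Sum>K\<in>snd ` p1. Sup K - Inf K) < d"
  proof -
    have "(\<Sum>K\<in>snd ` p1. Sup K - Inf K) = (\<Sum>K\<in>snd ` p1. measure lebesgue K)"
    proof (rule sum.cong[OF refl])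
      fix K assume "K \<in> snd ` p1"
      then obtain u v where "K = {u..v}" "u \<le> v" using iv pp(3) by force
      then show "Sup K - Inf K = measure lebesgue K" by simp
    qed
    also have "\<dots> = measure lebesgue (\<Union>(snd ` p1))"
      using content_division[OF div] by simp
    also have "\<dots> \<le> measure lebesgue U"
      using sub Ulm(1) div by (intro measure_mono_fmeasurable) (auto dest: lmeasurable_division)
    finally show ?thesis using Ulm(2) by simp
  qed
  have bad: "(\<Sum>(t,K)\<in>p1. \<bar>z (Sup K) - z (Inf K)\<bar>) < \<eta>"
  proof -
    \<comment> \<open>Different tags may share a degenerate interval, so passing from the sum over
      pairs to the sum over intervals requires the summand to vanish on intervals with empty
      interior. \<open>Sup {}\<close> and \<open>Inf {}\<close> have no useful values, hence the
      explicit 0.\<close>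
    define h where "h K = (if K = {} then 0 else \<bar>z (Sup K) - z (Inf K)\<bar>)" for K :: "real set"
    have "(\<Sum>(t,K)\<in>p1. \<bar>z (Sup K) - z (Inf K)\<bar>) = (\<Sum>(t,K)\<in>p1. h K)"
      using iv pp(3) by (intro sum.cong) (force simp: h_def)+
    also have "\<dots> = (\<Sum>K\<in>snd ` p1. h K)"
    proof (rule sum.over_tagged_division_lemma[OF p1U])
      fix u v :: real assume "box u v = {}"
      then have "v \<le> u" by (simp add: box_real)
      then show "h (cbox u v) = 0" by (cases "u = v") (auto simp: h_def)
    qed
    also have "\<dots> = (\<Sum>K\<in>snd ` p1. \<bar>z (Sup K) - z (Inf K)\<bar>)"
      using iv pp(3) by (intro sum.cong) (force simp: h_def)+
    also have "\<dots> < \<eta>"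
      using d[OF div _ sumK] sub by auto
    finally show ?thesis .
  qed
  have good: "(\<Sum>(t,K)\<in>p2. \<bar>z (Sup K) - z (Inf K)\<bar>) \<le> (\<Sum>(t,K)\<in>p2. (C + \<eta>) * (Sup K - Inf K))"
  proof (rule sum_mono, clarify)
    fix t K assume tK: "(t, K) \<in> p2"
    then have tK': "(t, K) \<in> p" "t \<notin> N" by (auto simp: p2_def)
    obtain u v where uv: "K = {u..v}" "u \<le> v" using iv[OF tK'(1)] by auto
    have t: "t \<in> K" "K \<subseteq> {a..b}" using pD(2,3)[OF tK'(1)] by auto
    have "K \<subseteq> \<gamma> t" using p(2) tK'(1) by (auto simp: fine_def)
    then have "K \<subseteq> ball t (r t)" using tK'(2) subsetD[OF t(2,1)] by (simp add: \<gamma>_def)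
    then have *: "u \<in> ball t (r t)" "v \<in> ball t (r t)"
      using uv atLeastAtMost_iff by blast+
    \<comment> \<open>Straddling: the tag lies between \<open>u\<close> and \<open>v\<close>, so the
      two estimates based at the tag add up to the length \<open>v - u\<close>.\<close>
    have "\<bar>z u - z t\<bar> \<le> (C + \<eta>) * \<bar>u - t\<bar>" "\<bar>z v - z t\<bar> \<le> (C + \<eta>) * \<bar>v - t\<bar>"
      using t uv tK' * by (intro r(2); auto simp: dist_real_def abs_minus_commute)+
    then have "\<bar>z u - z t\<bar> \<le> (C + \<eta>) * (t - u)" "\<bar>z v - z t\<bar> \<le> (C + \<eta>) * (v - t)"
      using t uv by auto
    then have "\<bar>z v - z u\<bar> \<le> (C + \<eta>) * (t - u) + (C + \<eta>) * (v - t)"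
      by linarith
    then show "\<bar>z (Sup K) - z (Inf K)\<bar> \<le> (C + \<eta>) * (Sup K - Inf K)"
      using uv by (simp add: algebra_simps)
  qed
  have "\<bar>z b - z a\<bar> = \<bar>\<Sum>(t,K)\<in>p. z (Sup K) - z (Inf K)\<bar>"
    using additive_tagged_division_1[OF \<open>a \<le> b\<close> p(1), of z] by simp
  also have "\<dots> \<le> (\<Sum>(t,K)\<in>p. \<bar>z (Sup K) - z (Inf K)\<bar>)"
    by (rule order_trans[OF sum_abs]) (simp add: case_prod_unfold)
  also have "\<dots> = (\<Sum>(t,K)\<in>p1. \<bar>z (Sup K) - z (Inf K)\<bar>) + (\<Sum>(t,K)\<in>p2. \<bar>z (Sup K) - z (Inf K)\<bar>)"
    unfolding pp(1) using pp by (intro sum.union_disjoint) auto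
  also have "\<dots> \<le> \<eta> + (\<Sum>(t,K)\<in>p2. (C + \<eta>) * (Sup K - Inf K))"
    using bad good by linarith
  also have "(\<Sum>(t,K)\<in>p2. (C + \<eta>) * (Sup K - Inf K)) \<le> (\<Sum>(t,K)\<in>p. (C + \<eta>) * (Sup K - Inf K))"
    using pp C \<eta>(1) pD(1) iv by (intro sum_mono2) force+
  also have "\<dots> = (C + \<eta>) * (b - a)"
    using additive_tagged_division_1[OF \<open>a \<le> b\<close> p(1), of "\<lambda>x. x"]
    by (simp add: sum_distrib_left[symmetric] case_prod_unfold)
  finally show "\<bar>z b - z a\<bar> \<le> C * (b - a) + e"
    using \<eta>(2) by (simp add: algebra_simps)
qed

lemma lipschitz_imp_absolutely_continuous_Icc:
  assumes "\<And>s t. s \<in> {a..b} \<Longrightarrow> t \<in> {a..b} \<Longrightarrow> \<bar>z t - z s\<bar> \<le> L * \<bar>t - s\<bar>"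
  shows "absolutely_continuous_Icc a b z"
  unfolding absolutely_continuous_Icc_def
proof (intro allI impI)
  fix e :: real assume "e > 0"
  define M where "M = \<bar>L\<bar> + 1"
  have "M > 0" by (simp add: M_def)
  show "\<exists>d>0. \<forall>\<D> S. \<D> division_of S \<and> S \<subseteq> {a..b} \<and> (\<Sum>K\<in>\<D>. Sup K - Inf K) < d
        \<longrightarrow> (\<Sum>K\<in>\<D>. \<bar>z (Sup K) - z (Inf K)\<bar>) < e"
  proof (intro exI[of _ "e / M"] conjI allI impI; (elim conjE)?)
    fix \<D> S assume D: "\<D> division_of S" "S \<subseteq> {a..b}" "(\<Sum>K\<in>\<D>. Sup K - Inf K) < e / M"
    have "(\<Sum>K\<in>\<D>. \<bar>z (Sup K) - z (Inf K)\<bar>) \<le> (\<Sum>K\<in>\<D>. M * (Sup K - Inf K))"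
    proof (rule sum_mono)
      fix K assume K: "K \<in> \<D>"
      then obtain u v where uv: "K = {u..v}" "K \<noteq> {}" using D(1) by (metis box_real(2) division_ofD(3,4))
      then have "u \<in> K" "v \<in> K" "u \<le> v" by auto
      then have "u \<in> {a..b}" "v \<in> {a..b}" using D K by (metis division_ofD(2) subsetD)+
      then have "\<bar>z v - z u\<bar> \<le> L * \<bar>v - u\<bar>" by (rule assms)
      also have "\<dots> \<le> M * \<bar>v - u\<bar>" by (intro mult_right_mono) (auto simp: M_def)
      finally show "\<bar>z (Sup K) - z (Inf K)\<bar> \<le> M * (Sup K - Inf K)" using uv \<open>u \<le> v\<close> by simp
    qed
    also have "\<dots> = M * (\<Sum>K\<in>\<D>. Sup K - Inf K)" by (simp add: sum_distrib_left)
    also have "\<dots> < e" using D(3) \<open>M > 0\<close> by (simp add: field_simps)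
    finally show "(\<Sum>K\<in>\<D>. \<bar>z (Sup K) - z (Inf K)\<bar>) < e" .
  qed (use \<open>e > 0\<close> \<open>M > 0\<close> in auto)
qed

lemma absolutely_continuous_Icc_diff:
  assumes "absolutely_continuous_Icc a b f" "absolutely_continuous_Icc a b g"
  shows "absolutely_continuous_Icc a b (\<lambda>t. f t - g t)"
  unfolding absolutely_continuous_Icc_def
proof (intro allI impI)
  fix e :: real assume "e > 0"
  then have "e / 2 > 0" by simp
  then obtain d1 where d1: "d1 > 0" "\<And>\<D> S. \<D> division_of S \<Longrightarrow> S \<subseteq> {a..b} \<Longrightarrow> (\<Sum>K\<in>\<D>. Sup K - Inf K) < d1
        \<Longrightarrow> (\<Sum>K\<in>\<D>. \<bar>f (Sup K) - f (Inf K)\<bar>) < e / 2"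
    using assms(1) unfolding absolutely_continuous_Icc_def by meson
  obtain d2 where d2: "d2 > 0" "\<And>\<D> S. \<D> division_of S \<Longrightarrow> S \<subseteq> {a..b} \<Longrightarrow> (\<Sum>K\<in>\<D>. Sup K - Inf K) < d2
        \<Longrightarrow> (\<Sum>K\<in>\<D>. \<bar>g (Sup K) - g (Inf K)\<bar>) < e / 2"
    using assms(2) \<open>e / 2 > 0\<close> unfolding absolutely_continuous_Icc_def by meson
  show "\<exists>d>0. \<forall>\<D> S. \<D> division_of S \<and> S \<subseteq> {a..b} \<and> (\<Sum>K\<in>\<D>. Sup K - Inf K) < d
        \<longrightarrow> (\<Sum>K\<in>\<D>. \<bar>f (Sup K) - g (Sup K) - (f (Inf K) - g (Inf K))\<bar>) < e"
  proof (intro exI[of _ "min d1 d2"] conjI allI impI; (elim conjE)?)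
    fix \<D> S assume D: "\<D> division_of S" "S \<subseteq> {a..b}" "(\<Sum>K\<in>\<D>. Sup K - Inf K) < min d1 d2"
    have "(\<Sum>K\<in>\<D>. \<bar>f (Sup K) - g (Sup K) - (f (Inf K) - g (Inf K))\<bar>)
        \<le> (\<Sum>K\<in>\<D>. \<bar>f (Sup K) - f (Inf K)\<bar> + \<bar>g (Sup K) - g (Inf K)\<bar>)"
      by (rule sum_mono) linarith
    also have "\<dots> < e"
      using d1(2)[OF D(1,2)] d2(2)[OF D(1,2)] D(3) by (simp add: sum.distrib)
    finally show "(\<Sum>K\<in>\<D>. \<bar>f (Sup K) - g (Sup K) - (f (Inf K) - g (Inf K))\<bar>) < e" .
  qed (use d1 d2 in auto)
qed

lemma absolutely_continuous_Icc_imp_continuous_on: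
  assumes ac: "absolutely_continuous_Icc a b f"
  shows "continuous_on {a..b} f"
  unfolding continuous_on_iff
proof (intro ballI allI impI)
  fix t e :: real assume t: "t \<in> {a..b}" and "e > 0"
  then obtain d where d: "d > 0" "\<And>\<D> S. \<D> division_of S \<Longrightarrow> S \<subseteq> {a..b} \<Longrightarrow> (\<Sum>K\<in>\<D>. Sup K - Inf K) < d
        \<Longrightarrow> (\<Sum>K\<in>\<D>. \<bar>f (Sup K) - f (Inf K)\<bar>) < e"
    using ac unfolding absolutely_continuous_Icc_def by meson
  have "\<bar>f v - f u\<bar> < e" if "u \<in> {a..b}" "v \<in> {a..b}" "u \<le> v" "v - u < d" for u v
  proof -
    have "{{u..v}} division_of {u..v}"
      using that by (metis atLeastatMost_empty_iff box_real(2) division_of_self linorder_not_less)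
    from d(2)[OF this] that show ?thesis by auto
  qed
  then have "\<bar>f s - f t\<bar> < e" if "s \<in> {a..b}" "\<bar>s - t\<bar> < d" for s
    using that t by (cases "s \<le> t") (force simp: abs_minus_commute)+
  with d(1) show "\<exists>d>0. \<forall>s\<in>{a..b}. dist s t < d \<longrightarrow> dist (f s) (f t) < e"
    by (auto simp: dist_real_def)
qed

section \<open>Lebesgue differentiation and the fundamental theorem for absolutely continuous
  functions\<close>

lemma integral_right_difference_quotient:
  fixes f :: "real \<Rightarrow> real"
  assumes "\<And>a b. f integrable_on {a..b}"
  obtains N where "negligible N"
    "\<And>x. x \<notin> N \<Longrightarrow> ((\<lambda>h. integral {x..x + h} f / h) \<longlongrightarrow> f x) (at_right 0)"
proof -
  obtain N where N: "negligible N" "\<And>x e. \<lbrakk>x \<notin> N; 0 < e\<rbrakk> \<Longrightarrow>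
               \<exists>d>0. \<forall>h. 0 < h \<and> h < d \<longrightarrow>
                         norm(integral (cbox x (x + h *\<^sub>R One)) f /\<^sub>R h ^ DIM(real) - f x) < e"
    using integrable_ccontinuous_explicit[of f] assms by (metis box_real(2))
  have "((\<lambda>h. integral {x..x + h} f / h) \<longlongrightarrow> f x) (at_right 0)" if "x \<notin> N" for x
    unfolding tendsto_iff eventually_at_right_field
    using N(2)[OF that] by (simp add: dist_real_def divide_inverse mult.commute) blast
  with N(1) show ?thesis using that by blast
qed

text \<open>Serves for the reflection of time (factor -1) and for the rescaling of time in the
  dithers (factor \<epsilon>).\<close>

lemma negligible_times_image:
  fixes N :: "real set"
  assumes "negligible N"
  shows "negligible ((\<lambda>t. k * t) ` N)"
  by (rule negligible_differentiable_image_negligible[OF order_refl assms]) auto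

text \<open>Differentiation over cubes with a fixed lower corner gives right-hand quotients only.
  The left-hand ones come from the same result for the time-reversed function.\<close>

lemma lebesgue_differentiation:
  fixes f :: "real \<Rightarrow> real"
  assumes f: "f integrable_on {a..b}"
  obtains N where "negligible N"
    "\<And>t. t \<in> {a..b} - N \<Longrightarrow> ((\<lambda>s. integral {a..s} f) has_real_derivative f t) (at t)"
proof -
  \<comment> \<open>Extension by zero makes the integrals over \<open>{t..t + h}\<close> meaningful
    for every \<open>t\<close> and \<open>h\<close>. The end points, where \<open>F\<close> and
    \<open>f\<close> may part, join the exceptional set.\<close>
  define F where "F s = (if s \<in> {a..b} then f s else 0)" for s
  have FU: "F integrable_on UNIV"
    using f unfolding F_def[abs_def] integrable_restrict_UNIV .
  then have F: "F integrable_on {u..v}" for u v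
    using integrable_on_subinterval by blast
  have Fr: "(\<lambda>s. F (- s)) integrable_on {u..v}" for u v
    using F[of "-v" "-u"] Henstock_Kurzweil_Integration.integrable_reflect_real[where f = F and a = "-v" and b = "-u"] by simp
  obtain N1 where N1: "negligible N1"
    "\<And>x. x \<notin> N1 \<Longrightarrow> ((\<lambda>h. integral {x..x + h} F / h) \<longlongrightarrow> F x) (at_right 0)"
    using integral_right_difference_quotient[of F] F by blast
  obtain N2 where N2: "negligible N2"
    "\<And>x. x \<notin> N2 \<Longrightarrow> ((\<lambda>h. integral {x..x + h} (\<lambda>s. F (- s)) / h) \<longlongrightarrow> F (- x)) (at_right 0)"
    using integral_right_difference_quotient[of "\<lambda>s. F (- s)"] Fr by blast
  define N where "N = N1 \<union> (\<lambda>t. - 1 * t) ` N2 \<union> {a, b}"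
  have "negligible N"
    unfolding N_def using negligible_times_image[OF N2(1), of "- 1"] N1(1) by (simp add: negligible_Un)
  moreover have "((\<lambda>s. integral {a..s} f) has_real_derivative f t) (at t)" if t: "t \<in> {a..b} - N" for t
  proof -
    have tab: "a < t" "t < b" and "t \<notin> N1" "- t \<notin> N2"
      using t by (auto simp: N_def image_iff)
    have "((\<lambda>h. integral {t..t + h} F / h) \<longlongrightarrow> F t) (at_right 0)"
      by (rule N1(2)) fact
    moreover have "\<forall>\<^sub>F h in at_right 0. integral {t..t + h} F / h = (integral {a..t + h} F - integral {a..t} F) / h"
    proof -
      have "integral {t..t + h} F = integral {a..t + h} F - integral {a..t} F" if "h > 0" for h
        using Henstock_Kurzweil_Integration.integral_combine[of a t "t + h" F] F tab that by simp
      then show ?thesis by (auto simp: eventually_at_right_field intro!: exI[of _ 1])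
    qed
    ultimately have R: "((\<lambda>h. (integral {a..t + h} F - integral {a..t} F) / h) \<longlongrightarrow> F t) (at_right 0)"
      by (rule Lim_transform_eventually)
    have "((\<lambda>h. integral {- t..- t + h} (\<lambda>s. F (- s)) / h) \<longlongrightarrow> F t) (at_right 0)"
      using N2(2)[OF \<open>- t \<notin> N2\<close>] by simp
    moreover have "\<forall>\<^sub>F h in at_right 0. integral {- t..- t + h} (\<lambda>s. F (- s)) / h
        = (integral {a..t + (- h)} F - integral {a..t} F) / (- h)"
    proof -
      have "integral {- t..- t + h} (\<lambda>s. F (- s)) = integral {a..t} F - integral {a..t - h} F" if "h > 0" "h < t - a" for h
      proof -
        have "integral {- t..- t + h} (\<lambda>s. F (- s)) = integral {t - h..t} F"
          using Henstock_Kurzweil_Integration.integral_reflect_real[of t "t - h" F] by simp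
        then show ?thesis
          using Henstock_Kurzweil_Integration.integral_combine[of a "t - h" t F] F tab that by simp
      qed
      then show ?thesis using tab by (auto simp: eventually_at_right_field field_simps intro!: exI[of _ "t - a"])
    qed
    ultimately have "((\<lambda>h. (integral {a..t + (- h)} F - integral {a..t} F) / (- h)) \<longlongrightarrow> F t) (at_right 0)"
      by (rule Lim_transform_eventually)
    then have L: "((\<lambda>h. (integral {a..t + h} F - integral {a..t} F) / h) \<longlongrightarrow> F t) (at_left 0)"
      by (subst filterlim_at_left_to_right) simp
    have "((\<lambda>h. (integral {a..t + h} F - integral {a..t} F) / h) \<longlongrightarrow> F t) (at 0)"
      using L R filterlim_split_at by blast
    then have "((\<lambda>s. integral {a..s} F) has_real_derivative F t) (at t)"
      by (simp add: DERIV_def)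
    moreover have "\<forall>\<^sub>F s in nhds t. integral {a..s} F = integral {a..s} f"
    proof -
      \<comment> \<open>A one-sided restriction does it: for \<open>s < a\<close> the interval
        \<open>{a..s}\<close> is empty and both integrals are 0.\<close>
      have "\<forall>\<^sub>F s in nhds t. s < b" using tab by (intro order_tendstoD(2)[OF filterlim_ident])
      then show ?thesis
        by eventually_elim (auto intro!: integral_cong simp: F_def)
    qed
    moreover have "F t = f t" using tab by (simp add: F_def)
    ultimately show ?thesis by (simp cong: DERIV_cong_ev)
  qed
  ultimately show ?thesis using that by blast
qed

lemma abs_integral_le:
  fixes w :: "real \<Rightarrow> real"
  assumes "u \<le> v" "w integrable_on {u..v}" "\<And>t. t \<in> {u..v} \<Longrightarrow> \<bar>w t\<bar> \<le> M"
  shows "\<bar>integral {u..v} w\<bar> \<le> M * (v - u)"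
  using integral_norm_bound_integral[of w "{u..v}" "\<lambda>_. M"] assms
  by (simp add: mult.commute integrable_const_ivl)

text \<open>The indefinite integral of \<open>w\<close> is Lipschitz because \<open>w\<close> is
  bounded, hence absolutely continuous. Its difference from \<open>z\<close> has derivative 0 off a
  null set, so the mean value bound with constant 0 makes the difference constant.\<close>

lemma absolutely_continuous_Icc_eq_integral:
  fixes z w :: "real \<Rightarrow> real"
  assumes "a \<le> b" and ac: "absolutely_continuous_Icc a b z"
    and N: "negligible N"
    and der: "\<And>t. t \<in> {a..b} - N \<Longrightarrow> (z has_real_derivative w t) (at t within {a..b})"
    and w: "w integrable_on {a..b}" and M: "\<And>t. t \<in> {a..b} \<Longrightarrow> \<bar>w t\<bar> \<le> M"
  shows "z b - z a = integral {a..b} w"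
proof -
  define W where "W s = integral {a..s} w" for s
  have wi: "w integrable_on {u..v}" if "a \<le> u" "v \<le> b" for u v
    using w that by (meson atLeastatMost_subset_iff integrable_on_subinterval)
  have "\<bar>W v - W u\<bar> \<le> M * \<bar>v - u\<bar>" if "u \<in> {a..b}" "v \<in> {a..b}" "u \<le> v" for u v
  proof -
    have "W v - W u = integral {u..v} w"
      unfolding W_def using Henstock_Kurzweil_Integration.integral_combine[of a u v w] wi that by simp
    moreover have "\<bar>integral {u..v} w\<bar> \<le> M * (v - u)"
      using wi M that by (intro abs_integral_le) auto
    ultimately show ?thesis using that by simp
  qed
  then have lip: "\<bar>W t - W s\<bar> \<le> M * \<bar>t - s\<bar>" if "s \<in> {a..b}" "t \<in> {a..b}" for s t
    using that by (metis abs_minus_commute linorder_linear)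
  obtain N' where N': "negligible N'" "\<And>t. t \<in> {a..b} - N' \<Longrightarrow> (W has_real_derivative w t) (at t)"
    unfolding W_def using lebesgue_differentiation[OF w] by metis
  have "\<bar>(z b - W b) - (z a - W a)\<bar> \<le> 0 * (b - a)"
  proof (rule absolutely_continuous_Icc_mean_value[OF \<open>a \<le> b\<close>, where N = "N \<union> N'" and w = "\<lambda>t. w t - w t"])
    show "absolutely_continuous_Icc a b (\<lambda>t. z t - W t)"
      by (rule absolutely_continuous_Icc_diff[OF ac lipschitz_imp_absolutely_continuous_Icc[OF lip]])
    show "((\<lambda>t. z t - W t) has_real_derivative w t - w t) (at t within {a..b}) \<and> \<bar>w t - w t\<bar> \<le> 0"
      if "t \<in> {a..b} - (N \<union> N')" for t
      using DERIV_diff[OF der has_field_derivative_at_within[OF N'(2)]] that by simp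
  qed (use N N' in auto)
  then show ?thesis by (simp add: W_def)
qed

section \<open>Functions of class \<open>C\<^sup>n\<close> and Lie derivatives\<close>

lemma Cn_on_0 [simp]: "Cn_on 0 D f \<longleftrightarrow> continuous_on D f"
  by (simp add: Cn_on_def)

text \<open>Peels off the innermost derivative, so that inductions on the order replace
  \<open>f\<close> by \<open>deriv f\<close>.\<close>

lemma Cn_on_Suc: "Cn_on (Suc n) D f \<longleftrightarrow> (\<forall>x\<in>D. f field_differentiable at x) \<and> Cn_on n D (deriv f)"
proof -
  have "(deriv ^^ Suc j) f = (deriv ^^ j) (deriv f)" for j
    by (simp add: funpow_Suc_right del: funpow.simps)
  then show ?thesis unfolding Cn_on_def All_less_Suc2 by auto
qed

text \<open>On an open set, agreement spreads to neighbourhoods and so to derivatives. This permits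
  replacing \<open>lie_deriv\<close> and derivatives of sums and products by formulas that are known
  on \<open>D\<close> only.\<close>

lemma Cn_on_cong:
  assumes "open D" "\<And>x. x \<in> D \<Longrightarrow> f x = g x" "Cn_on n D f"
  shows "Cn_on n D g"
  using assms(2,3)
proof (induction n arbitrary: f g)
  case 0
  then show ?case using continuous_on_cong by (metis Cn_on_0)
next
  case (Suc n)
  have ev: "\<forall>\<^sub>F y in nhds x. f y = g y" if "x \<in> D" for x
    using that Suc.prems(1) \<open>open D\<close> by (auto simp: eventually_nhds)
  have "g field_differentiable at x" if "x \<in> D" for x
    using Suc.prems(2) that DERIV_cong_ev[OF refl ev[OF that] refl]
    unfolding Cn_on_Suc field_differentiable_def by blast
  moreover have "Cn_on n D (deriv g)"
  proof (rule Suc.IH)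
    show "deriv f x = deriv g x" if "x \<in> D" for x
      by (rule deriv_cong_ev[OF ev[OF that] refl])
    show "Cn_on n D (deriv f)" using Suc.prems(2) by (simp add: Cn_on_Suc)
  qed
  ultimately show ?case by (simp add: Cn_on_Suc)
qed

lemma Cn_on_Suc_imp: "Cn_on (Suc n) D f \<Longrightarrow> Cn_on n D f"
proof (induction n arbitrary: f)
  case 0
  then show ?case
    by (auto simp: Cn_on_Suc intro!: continuous_at_imp_continuous_on field_differentiable_imp_continuous_at)
next
  case (Suc n)
  then show ?case by (metis Cn_on_Suc)
qed

lemma Cn_on_mono: "Cn_on n D f \<Longrightarrow> k \<le> n \<Longrightarrow> Cn_on k D f"
  by (induction n) (auto simp: le_Suc_eq dest: Cn_on_Suc_imp)

lemma Cn_on_add: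
  assumes "open D" "Cn_on n D f" "Cn_on n D g"
  shows "Cn_on n D (\<lambda>x. f x + g x)"
  using assms(2,3)
proof (induction n arbitrary: f g)
  case 0
  then show ?case by (simp add: continuous_on_add)
next
  case (Suc n)
  have "Cn_on n D (\<lambda>x. deriv f x + deriv g x)"
    using Suc by (simp add: Cn_on_Suc)
  then have "Cn_on n D (deriv (\<lambda>x. f x + g x))"
    by (rule Cn_on_cong[OF \<open>open D\<close>, rotated]) (use Suc.prems in \<open>simp add: Cn_on_Suc\<close>)
  then show ?case using Suc.prems by (simp add: Cn_on_Suc field_differentiable_add)
qed

lemma Cn_on_mult:
  assumes "open D" "Cn_on n D f" "Cn_on n D g"
  shows "Cn_on n D (\<lambda>x. f x * g x)"
  using assms(2,3)
proof (induction n arbitrary: f g)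
  case 0
  then show ?case by (simp add: continuous_on_mult)
next
  case (Suc n)
  have "Cn_on n D (\<lambda>x. f x * deriv g x + deriv f x * g x)"
    using Suc Cn_on_Suc_imp[of n D] by (intro Cn_on_add[OF \<open>open D\<close>]) (simp_all add: Cn_on_Suc)
  then have "Cn_on n D (deriv (\<lambda>x. f x * g x))"
    by (rule Cn_on_cong[OF \<open>open D\<close>, rotated]) (use Suc.prems in \<open>simp add: Cn_on_Suc\<close>)
  then show ?case using Suc.prems by (simp add: Cn_on_Suc field_differentiable_mult)
qed

lemma Cn_on_lie_deriv:
  assumes "open D" "Cn_on (Suc n) D f" "Cn_on n D h"
  shows "Cn_on n D (lie_deriv h f)"
proof (rule Cn_on_cong[OF \<open>open D\<close>])
  show "Cn_on n D (\<lambda>x. deriv f x * h x)"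
    using assms by (intro Cn_on_mult) (auto simp: Cn_on_Suc)
  show "deriv f x * h x = lie_deriv h f x" if "x \<in> D" for x
    using assms(2) that by (simp add: Cn_on_Suc lie_deriv_eq)
qed

text \<open>Each Lie derivative costs one order. After \<open>m\<close> of them a function of class
  C^m is left continuous, which is the regularity used to bound words of length
  \<open>m + 1\<close>.\<close>

lemma Cn_on_foldl_lie_deriv:
  assumes "open D" "\<And>k. k \<in> A \<Longrightarrow> Cn_on n D (G k)" "Cn_on n D f"
    and "set ks \<subseteq> A" "length ks \<le> n"
  shows "Cn_on (n - length ks) D (foldl (\<lambda>f k. lie_deriv (G k) f) f ks)"
  using assms(2-)
proof (induction ks arbitrary: n f)
  case Nil
  then show ?case by simp
next
  case (Cons k ks)
  from Cons.prems(4) obtain n' where n: "n = Suc n'" by (cases n) auto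
  have "Cn_on (n' - length ks) D (foldl (\<lambda>f k. lie_deriv (G k) f) (lie_deriv (G k) f) ks)"
  proof (rule Cons.IH)
    show "Cn_on n' D (G j)" if "j \<in> A" for j
      using Cons.prems(1)[OF that] n Cn_on_Suc_imp by blast
    show "Cn_on n' D (lie_deriv (G k) f)"
      using Cons.prems n Cn_on_Suc_imp by (intro Cn_on_lie_deriv[OF \<open>open D\<close>]) auto
  qed (use Cons.prems n in auto)
  then show ?case using n by simp
qed

text \<open>The expansion is run with the identity as observable; the first letter of a word then
  produces the field itself, as in \<open>iterated_lie_deriv\<close>.\<close>

lemma lie_deriv_id [simp]: "lie_deriv h (\<lambda>y. y) = h"
proof
  fix x
  have "(\<lambda>s. (x + s * h x - x) / s) \<midarrow>0\<rightarrow> h x"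
    by (rule tendsto_eventually) (simp add: eventually_at_filter)
  then show "lie_deriv h (\<lambda>y. y) x = h x"
    unfolding lie_deriv_def by (intro tendsto_Lim) simp_all
qed

lemma Cn_on_1_lipschitz:
  assumes "Cn_on 1 D f" "{p..q} \<subseteq> D"
  obtains L where "L \<ge> 0" "\<And>x y. x \<in> {p..q} \<Longrightarrow> y \<in> {p..q} \<Longrightarrow> \<bar>f x - f y\<bar> \<le> L * \<bar>x - y\<bar>"
proof -
  have f: "\<And>x. x \<in> D \<Longrightarrow> f field_differentiable at x" and c: "continuous_on D (deriv f)"
    using assms(1) Cn_on_Suc[of 0] by auto
  have "compact (deriv f ` {p..q})"
    using continuous_on_subset[OF c assms(2)] compact_Icc by (rule compact_continuous_image)
  then obtain L where L: "\<And>x. x \<in> {p..q} \<Longrightarrow> \<bar>deriv f x\<bar> \<le> L"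
    using compact_imp_bounded bounded_iff by (metis imageI real_norm_def)
  have "\<bar>f x - f y\<bar> \<le> \<bar>L\<bar> * \<bar>x - y\<bar>" if "x \<in> {p..q}" "y \<in> {p..q}" for x y
  proof -
    have "norm (f x - f y) \<le> \<bar>L\<bar> * norm (x - y)"
    proof (rule field_differentiable_bound[where S = "{p..q}" and f' = "deriv f"])
      show "(f has_field_derivative deriv f z) (at z within {p..q})" if "z \<in> {p..q}" for z
        using f that assms(2) by (meson DERIV_deriv_iff_field_differentiable has_field_derivative_at_within subsetD)
      show "norm (deriv f z) \<le> \<bar>L\<bar>" if "z \<in> {p..q}" for z
        using L[OF that] by simp
    qed (use that in auto)
    then show ?thesis by simp
  qed
  with that[of "\<bar>L\<bar>"] show ?thesis by simp
qed

section \<open>Iterated integrals of bounded measurable inputs\<close>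

lemma continuous_mult_bounded_integrable:
  fixes h u :: "real \<Rightarrow> real"
  assumes "continuous_on {a..b} h" "u \<in> borel_measurable lebesgue" "\<And>t. \<bar>u t\<bar> \<le> U"
  shows "(\<lambda>s. u s * h s) absolutely_integrable_on {a..b}"
proof (rule absolutely_integrable_bounded_measurable_product_real)
  show "u \<in> borel_measurable (lebesgue_on {a..b})"
    using assms(2) by (simp add: measurable_restrict_space1)
  show "bounded (u ` {a..b})"
    using assms(3) by (auto simp: bounded_iff intro!: exI[of _ U])
  show "h absolutely_integrable_on {a..b}"
    by (rule absolutely_integrable_continuous_real[OF assms(1)])
qed auto

text \<open>Continuity of the inner integral makes the next integrand a bounded measurable function
  times a continuous one, hence integrable; its indefinite integral is continuous again.\<close>

lemma continuous_on_iterated_integral: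
  assumes "\<And>k. k \<in> set ks \<Longrightarrow> u k \<in> borel_measurable lebesgue" "\<And>k t. k \<in> set ks \<Longrightarrow> \<bar>u k t\<bar> \<le> U"
  shows "continuous_on {0..T} (iterated_integral u ks)"
  using assms
proof (induction ks)
  case Nil
  have "iterated_integral u [] = (\<lambda>t. 1)" by auto
  then show ?case by simp
next
  case (Cons k ks)
  have int: "(\<lambda>s. u k s * iterated_integral u ks s) absolutely_integrable_on {0..T'}" if "T' \<le> T" for T'
    using Cons that by (intro continuous_mult_bounded_integrable[where U = U])
      (auto intro: continuous_on_subset)
  have "continuous_on {0..T} (\<lambda>t. integral {0..t} (\<lambda>s. u k s * iterated_integral u ks s))"
    using set_lebesgue_integral_eq_integral(1)[OF int[OF order_refl]]
    by (rule indefinite_integral_continuous_1)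
  then show ?case
    by (rule continuous_on_eq) (use set_lebesgue_integral_eq_integral(2)[OF int] in auto)
qed

text \<open>Passes from the Lebesgue integral of the definition to the gauge integral in which the
  estimates are made.\<close>

lemma iterated_integral_Cons_eq:
  assumes "\<And>j. j \<in> set (k # ks) \<Longrightarrow> u j \<in> borel_measurable lebesgue" "\<And>j t. j \<in> set (k # ks) \<Longrightarrow> \<bar>u j t\<bar> \<le> U"
  shows "iterated_integral u (k # ks) t = integral {0..t} (\<lambda>s. u k s * iterated_integral u ks s)"
  using assms unfolding iterated_integral.simps
  by (intro set_lebesgue_integral_eq_integral(2) continuous_mult_bounded_integrable[where U = U]
      continuous_on_iterated_integral[where U = U]) auto

section \<open>The remainder of the Chen-Fliess expansion\<close>

text \<open>The bound holds at every time, not almost everywhere; essentially bounded dithers enter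
  after truncation.\<close>

locale bounded_input =
  fixes A :: "nat set" and u :: "nat \<Rightarrow> real \<Rightarrow> real" and U :: real
  assumes finite_A: "finite A"
    and u_measurable: "\<And>k. k \<in> A \<Longrightarrow> u k \<in> borel_measurable lebesgue"
    and u_bound: "\<And>k t. k \<in> A \<Longrightarrow> \<bar>u k t\<bar> \<le> U"
begin

lemma integrable_input_mult:
  assumes "k \<in> A" "continuous_on {0..T} h" "t \<le> T"
  shows "(\<lambda>s. u k s * h s) integrable_on {0..t}"
proof (rule set_lebesgue_integral_eq_integral(1)[OF continuous_mult_bounded_integrable])
  show "continuous_on {0..t} h" using assms(2,3) by (rule_tac continuous_on_subset) auto
qed (use u_measurable[OF assms(1)] u_bound[OF assms(1)] in blast)+

lemma U_nonneg: "k \<in> A \<Longrightarrow> U \<ge> 0"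
  using u_bound[of k 0] by linarith

end

text \<open>The trajectory is given by its integral equation, which is what Picard iteration
  delivers and what survives a shift by one period.\<close>

locale bounded_input_trajectory = bounded_input +
  fixes D :: "real set" and G :: "nat \<Rightarrow> real \<Rightarrow> real"
    and p q T x0 :: real and x :: "real \<Rightarrow> real"
  assumes open_D: "open D" and pq: "{p..q} \<subseteq> D"
    and G_C1: "\<And>k. k \<in> A \<Longrightarrow> Cn_on 1 D (G k)"
    and x_cont: "continuous_on {0..T} x"
    and x_range: "\<And>t. t \<in> {0..T} \<Longrightarrow> x t \<in> {p..q}"
    and x_integral: "\<And>t. t \<in> {0..T} \<Longrightarrow> x t = x0 + integral {0..t} (\<lambda>s. \<Sum>k\<in>A. u k s * G k (x s))"
begin

abbreviation "iter_lie \<phi> ks \<equiv> foldl (\<lambda>f k. lie_deriv (G k) f) \<phi> ks"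

lemma continuous_on_along: "continuous_on D f \<Longrightarrow> continuous_on {0..T} (\<lambda>s. f (x s))"
  by (rule continuous_on_compose2[of D f, OF _ x_cont]) (use x_range pq in blast)+

lemma continuous_on_G: "k \<in> A \<Longrightarrow> continuous_on D (G k)"
  using Cn_on_mono[OF G_C1, of k 0] by simp

lemma bounded_velocity:
  obtains M where "\<And>s. s \<in> {0..T} \<Longrightarrow> \<bar>\<Sum>k\<in>A. u k s * G k (x s)\<bar> \<le> M"
proof -
  have "\<exists>B. \<forall>s\<in>{0..T}. \<bar>G k (x s)\<bar> \<le> B" if "k \<in> A" for k
  proof -
    have "compact ((\<lambda>s. G k (x s)) ` {0..T})"
      by (rule compact_continuous_image[OF continuous_on_along[OF continuous_on_G[OF that]]]) auto
    then show ?thesis using compact_imp_bounded bounded_iff by (metis imageI real_norm_def)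
  qed
  then obtain B where B: "\<And>k s. k \<in> A \<Longrightarrow> s \<in> {0..T} \<Longrightarrow> \<bar>G k (x s)\<bar> \<le> B k" by metis
  have "\<bar>\<Sum>k\<in>A. u k s * G k (x s)\<bar> \<le> (\<Sum>k\<in>A. U * B k)" if "s \<in> {0..T}" for s
  proof (rule order_trans[OF sum_abs sum_mono])
    show "\<bar>u k s * G k (x s)\<bar> \<le> U * B k" if "k \<in> A" for k
      unfolding abs_mult using B[OF that \<open>s \<in> {0..T}\<close>] u_bound[OF that] U_nonneg[OF that]
      by (intro mult_mono) auto
  qed
  then show ?thesis using that by blast
qed

text \<open>Both \<open>x\<close> on \<open>{0..T}\<close> and \<phi> on \<open>{p..q}\<close> are
  Lipschitz, so their composition is absolutely continuous; its derivative exists almost everywhere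
  by the chain rule, and the fundamental theorem recovers the function. Iterating this identity
  produces the expansion.\<close>

lemma chain_rule_integral:
  assumes \<phi>: "Cn_on 1 D \<phi>" and t: "t \<in> {0..T}"
  shows "\<phi> (x t) = \<phi> x0 + (\<Sum>k\<in>A. integral {0..t} (\<lambda>s. u k s * lie_deriv (G k) \<phi> (x s)))"
proof -
  define w where "w s = (\<Sum>k\<in>A. u k s * G k (x s))" for s
  obtain M where M: "\<And>s. s \<in> {0..T} \<Longrightarrow> \<bar>w s\<bar> \<le> M" unfolding w_def by (rule bounded_velocity) blast
  have wi: "w integrable_on {0..s}" if "s \<le> T" for s
    unfolding w_def using finite_A integrable_input_mult[OF _ continuous_on_along[OF continuous_on_G] that] by (intro integrable_sum) auto
  have "\<bar>x b - x a\<bar> \<le> M * \<bar>b - a\<bar>" if "a \<in> {0..T}" "b \<in> {0..T}" "a \<le> b" for a b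
  proof -
    have "x b - x a = integral {a..b} w"
      using x_integral[OF that(1)] x_integral[OF that(2)] that
        Henstock_Kurzweil_Integration.integral_combine[of 0 a b w] wi[of b] by (simp add: w_def[abs_def])
    moreover have "w integrable_on {a..b}"
      using wi[of b] that by (rule_tac integrable_on_subinterval[of w "{0..b}"]) auto
    then have "\<bar>integral {a..b} w\<bar> \<le> M * (b - a)"
      using M that by (intro abs_integral_le) auto
    ultimately show ?thesis using that by simp
  qed
  then have lipx: "\<bar>x b - x a\<bar> \<le> M * \<bar>b - a\<bar>" if "a \<in> {0..T}" "b \<in> {0..T}" for a b
    using that by (metis abs_minus_commute linorder_linear)
  obtain N where N: "negligible N"
      "\<And>s. s \<in> {0..T} - N \<Longrightarrow> ((\<lambda>s. integral {0..s} w) has_real_derivative w s) (at s)"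
    using lebesgue_differentiation[OF wi[OF order_refl]] by metis
  have dx: "(x has_real_derivative w s) (at s within {0..t})" if "s \<in> {0..t} - N" for s
  proof -
    have "((\<lambda>s. x0 + integral {0..s} w) has_real_derivative 0 + w s) (at s within {0..t})"
      using that t by (intro DERIV_add DERIV_const has_field_derivative_at_within[OF N(2)]) auto
    then show ?thesis
      unfolding add_0 by (rule has_field_derivative_transform_within[OF _ zero_less_one])
         (use that t x_integral in \<open>auto simp: w_def[abs_def]\<close>)
  qed
  obtain L where L: "L \<ge> 0" "\<And>x y. x \<in> {p..q} \<Longrightarrow> y \<in> {p..q} \<Longrightarrow> \<bar>\<phi> x - \<phi> y\<bar> \<le> L * \<bar>x - y\<bar>"
    using Cn_on_1_lipschitz[OF \<phi> pq] by blast
  have \<phi>d: "\<And>y. y \<in> D \<Longrightarrow> \<phi> field_differentiable at y" and \<phi>c: "continuous_on D (deriv \<phi>)"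
    using \<phi> Cn_on_Suc[of 0] by auto
  have lc: "continuous_on D (lie_deriv (G k) \<phi>)" if "k \<in> A" for k
    using Cn_on_lie_deriv[of D 0 \<phi> "G k"] \<phi> open_D continuous_on_G[OF that] by simp
  define W where "W s = deriv \<phi> (x s) * w s" for s
  have Weq: "W s = (\<Sum>k\<in>A. u k s * lie_deriv (G k) \<phi> (x s))" if "s \<in> {0..T}" for s
  proof -
    have "x s \<in> D" using x_range that pq by blast
    then show ?thesis using \<phi>d unfolding W_def w_def sum_distrib_left
      by (intro sum.cong) (auto simp: lie_deriv_eq algebra_simps)
  qed
  have ui: "(\<lambda>s. u k s * lie_deriv (G k) \<phi> (x s)) integrable_on {0..t}" if "k \<in> A" for k
    by (rule integrable_input_mult[OF that continuous_on_along[OF lc[OF that]]]) (use t in auto)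
  have Wi: "W integrable_on {0..t}"
    by (rule integrable_eq[OF integrable_sum[OF finite_A ui]]) (use Weq t in auto)
  have "compact ((\<lambda>s. deriv \<phi> (x s)) ` {0..T})"
    by (rule compact_continuous_image[OF continuous_on_along[OF \<phi>c]]) auto
  then obtain C where C: "\<And>s. s \<in> {0..T} \<Longrightarrow> \<bar>deriv \<phi> (x s)\<bar> \<le> C"
    using compact_imp_bounded bounded_iff by (metis imageI real_norm_def)
  have "\<phi> (x t) - \<phi> (x 0) = integral {0..t} W"
  proof (rule absolutely_continuous_Icc_eq_integral[OF _ _ N(1) _ Wi])
    show "absolutely_continuous_Icc 0 t (\<lambda>s. \<phi> (x s))"
    proof (rule lipschitz_imp_absolutely_continuous_Icc)
      fix a b assume ab: "a \<in> {0..t}" "b \<in> {0..t}"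
      then have ab': "a \<in> {0..T}" "b \<in> {0..T}" using t by auto
      then have "\<bar>\<phi> (x b) - \<phi> (x a)\<bar> \<le> L * \<bar>x b - x a\<bar>" by (intro L(2) x_range)
      also have "\<dots> \<le> L * (M * \<bar>b - a\<bar>)" by (intro mult_left_mono lipx ab' L(1))
      finally show "\<bar>\<phi> (x b) - \<phi> (x a)\<bar> \<le> (L * M) * \<bar>b - a\<bar>" by (simp add: mult.assoc)
    qed
    show "((\<lambda>s. \<phi> (x s)) has_real_derivative W s) (at s within {0..t})" if "s \<in> {0..t} - N" for s
    proof -
      have "x s \<in> D" using x_range[of s] that pq t by auto
      then have "(\<phi> has_real_derivative deriv \<phi> (x s)) (at (x s))"
        using \<phi>d DERIV_deriv_iff_field_differentiable by blast
      from DERIV_chain2[OF this dx[OF that]] show ?thesis unfolding W_def .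
    qed
    show "\<bar>W s\<bar> \<le> C * M" if "s \<in> {0..t}" for s
    proof -
      have "s \<in> {0..T}" using that t by auto
      then show ?thesis
        unfolding W_def abs_mult using M[of s] C[of s] by (intro mult_mono) auto
    qed
  qed (use t in auto)
  also have "integral {0..t} W = integral {0..t} (\<lambda>s. \<Sum>k\<in>A. u k s * lie_deriv (G k) \<phi> (x s))"
    by (rule integral_cong) (use Weq t in auto)
  also have "\<dots> = (\<Sum>k\<in>A. integral {0..t} (\<lambda>s. u k s * lie_deriv (G k) \<phi> (x s)))"
    by (rule integral_sum[OF finite_A ui])
  also have "x 0 = x0" using x_integral[of 0] t by simp
  finally show ?thesis by simp
qed

text \<open>Word lengths run from 0 to \<open>n - 1\<close>, and the empty word contributes
  \<open>\<phi> x0\<close>. For the identity, \<open>expansion (Suc m)\<close> is therefore the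
  initial value plus the Chen-Fliess sum of order \<open>m\<close>.\<close>

definition expansion :: "nat \<Rightarrow> (real \<Rightarrow> real) \<Rightarrow> real \<Rightarrow> real" where
  "expansion n \<phi> t = (\<Sum>l<n. \<Sum>ks\<in>{ks. set ks \<subseteq> A \<and> length ks = l}. iter_lie \<phi> ks x0 * iterated_integral u ks t)"

lemma continuous_on_iterated_integral_input: "set ks \<subseteq> A \<Longrightarrow> continuous_on {0..T} (iterated_integral u ks)"
  by (rule continuous_on_iterated_integral[where U = U]) (use u_measurable u_bound in blast)+

lemma continuous_on_expansion: "continuous_on {0..T} (expansion n \<phi>)"
  unfolding expansion_def by (intro continuous_intros continuous_on_iterated_integral_input) auto

lemma sum_lists_Suc:
  fixes f :: "nat list \<Rightarrow> real"
  shows "(\<Sum>ks\<in>{ks. set ks \<subseteq> A \<and> length ks = Suc l}. f ks)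
       = (\<Sum>k\<in>A. \<Sum>ks\<in>{ks. set ks \<subseteq> A \<and> length ks = l}. f (k # ks))"
proof -
  have *: "{ks. set ks \<subseteq> A \<and> length ks = Suc l}
      = (\<lambda>(k, ks). k # ks) ` (A \<times> {ks. set ks \<subseteq> A \<and> length ks = l})"
    by (auto simp: length_Suc_conv image_iff)
  show ?thesis
    unfolding * by (subst sum.reindex) (auto simp: inj_on_def sum.cartesian_product case_prod_unfold)
qed

text \<open>Words are split by their first letter, which belongs both to the first Lie derivative
  and to the outermost integral. The recursion thus has the same shape as the integrated chain
  rule.\<close>

lemma expansion_Suc:
  assumes t: "t \<in> {0..T}"
  shows "expansion (Suc n) \<phi> t
    = \<phi> x0 + (\<Sum>k\<in>A. integral {0..t} (\<lambda>s. u k s * expansion n (lie_deriv (G k) \<phi>) s))"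
proof -
  let ?S = "\<lambda>l. {ks. set ks \<subseteq> A \<and> length ks = l}"
  have fin: "finite (?S l)" for l using finite_lists_length_eq[OF finite_A] .
  have S0: "?S 0 = {[]}" by auto
  have "expansion (Suc n) \<phi> t = \<phi> x0 + (\<Sum>l<n. \<Sum>k\<in>A. \<Sum>ks\<in>?S l. iter_lie \<phi> (k # ks) x0 * iterated_integral u (k # ks) t)"
    unfolding expansion_def sum.lessThan_Suc_shift sum_lists_Suc S0 by simp
  also have "(\<Sum>l<n. \<Sum>k\<in>A. \<Sum>ks\<in>?S l. iter_lie \<phi> (k # ks) x0 * iterated_integral u (k # ks) t)
      = (\<Sum>k\<in>A. \<Sum>l<n. \<Sum>ks\<in>?S l. iter_lie \<phi> (k # ks) x0 * iterated_integral u (k # ks) t)"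
    by (rule sum.swap)
  also have "\<dots> = (\<Sum>k\<in>A. integral {0..t} (\<lambda>s. u k s * expansion n (lie_deriv (G k) \<phi>) s))"
  proof (rule sum.cong[OF refl])
    fix k assume k: "k \<in> A"
    have ii: "((\<lambda>s. u k s * iterated_integral u ks s) has_integral iterated_integral u (k # ks) t) {0..t}"
      if "ks \<in> ?S l" for ks l
    proof -
      have ks: "set ks \<subseteq> A" using that by simp
      have "(\<lambda>s. u k s * iterated_integral u ks s) integrable_on {0..t}"
        by (rule integrable_input_mult[OF k continuous_on_iterated_integral_input[OF ks]]) (use t in simp)
      moreover have "iterated_integral u (k # ks) t = integral {0..t} (\<lambda>s. u k s * iterated_integral u ks s)"
        by (rule iterated_integral_Cons_eq[where U = U]) (use u_measurable u_bound k ks in auto)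
      ultimately show ?thesis by (metis has_integral_integral)
    qed
    have "((\<lambda>s. \<Sum>l<n. \<Sum>ks\<in>?S l. iter_lie \<phi> (k # ks) x0 * (u k s * iterated_integral u ks s)) has_integral
        (\<Sum>l<n. \<Sum>ks\<in>?S l. iter_lie \<phi> (k # ks) x0 * iterated_integral u (k # ks) t)) {0..t}"
      by (rule has_integral_sum[OF _ has_integral_sum[OF fin has_integral_mult_right[OF ii]]]) auto
    then show "(\<Sum>l<n. \<Sum>ks\<in>?S l. iter_lie \<phi> (k # ks) x0 * iterated_integral u (k # ks) t)
        = integral {0..t} (\<lambda>s. u k s * expansion n (lie_deriv (G k) \<phi>) s)"
      by (simp add: expansion_def sum_distrib_left mult_ac integral_unique)
  qed
  finally show ?thesis .
qed

text \<open>Subtracting \<open>expansion_Suc\<close> from the chain rule writes the remainder of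
  \<phi> through integrals of the remainders, one order lower, of its Lie derivatives; each round
  contributes a factor \<open>card A * U * t\<close>. Replacing \<open>s\<close> by \<open>t\<close>
  inside the power gives up a factorial but no power of \<open>t\<close>.\<close>

lemma expansion_remainder:
  assumes "B \<ge> 0"
    and "\<And>ks. set ks \<subseteq> A \<Longrightarrow> length ks < n \<Longrightarrow> Cn_on 1 D (iter_lie \<phi> ks)"
    and "\<And>ks y. set ks \<subseteq> A \<Longrightarrow> length ks = n \<Longrightarrow> y \<in> {p..q} \<Longrightarrow> \<bar>iter_lie \<phi> ks y\<bar> \<le> B"
    and "t \<in> {0..T}"
  shows "\<bar>\<phi> (x t) - expansion n \<phi> t\<bar> \<le> B * (real (card A) * U * t) ^ n"
  using assms(2-)
proof (induction n arbitrary: \<phi> t)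
  case 0
  have "\<bar>iter_lie \<phi> [] (x t)\<bar> \<le> B" by (rule 0(2)) (use x_range[OF 0(3)] in auto)
  then show ?case by (simp add: expansion_def)
next
  case (Suc n)
  have tT: "t \<le> T" "0 \<le> t" using Suc.prems(3) by auto
  have \<phi>1: "Cn_on 1 D \<phi>" using Suc.prems(1)[of "[]"] by simp
  have lc: "continuous_on {0..T} (\<lambda>s. lie_deriv (G k) \<phi> (x s))" if "k \<in> A" for k
    using Cn_on_lie_deriv[of D 0 \<phi> "G k"] \<phi>1 open_D continuous_on_G[OF that] by (intro continuous_on_along) simp
  have bd: "\<bar>integral {0..t} (\<lambda>s. u k s * lie_deriv (G k) \<phi> (x s)) - integral {0..t} (\<lambda>s. u k s * expansion n (lie_deriv (G k) \<phi>) s)\<bar>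
      \<le> U * (B * (real (card A) * U * t) ^ n) * t" if k: "k \<in> A" for k
  proof -
    let ?f = "\<lambda>s. u k s * (lie_deriv (G k) \<phi> (x s) - expansion n (lie_deriv (G k) \<phi>) s)"
    have i: "?f integrable_on {0..t}"
      by (rule integrable_input_mult[OF k continuous_on_diff[OF lc[OF k] continuous_on_expansion] tT(1)])
    have "integral {0..t} (\<lambda>s. u k s * lie_deriv (G k) \<phi> (x s)) - integral {0..t} (\<lambda>s. u k s * expansion n (lie_deriv (G k) \<phi>) s)
        = integral {0..t} ?f"
      unfolding right_diff_distrib
      by (rule integral_diff[symmetric, OF integrable_input_mult[OF k lc[OF k] tT(1)] integrable_input_mult[OF k continuous_on_expansion tT(1)]])
    moreover have "\<bar>integral {0..t} ?f\<bar> \<le> U * (B * (real (card A) * U * t) ^ n) * (t - 0)"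
    proof (rule abs_integral_le[OF tT(2) i])
      fix s assume s: "s \<in> {0..t}"
      have "\<bar>lie_deriv (G k) \<phi> (x s) - expansion n (lie_deriv (G k) \<phi>) s\<bar> \<le> B * (real (card A) * U * s) ^ n"
      proof (rule Suc.IH)
        fix ks assume ks: "set ks \<subseteq> A"
        show "Cn_on 1 D (iter_lie (lie_deriv (G k) \<phi>) ks)" if "length ks < n"
          using Suc.prems(1)[of "k # ks"] ks that k by simp
        show "\<bar>iter_lie (lie_deriv (G k) \<phi>) ks y\<bar> \<le> B" if "length ks = n" "y \<in> {p..q}" for y
          using Suc.prems(2)[of "k # ks" y] ks that k by simp
      qed (use s tT in auto)
      also have "\<dots> \<le> B * (real (card A) * U * t) ^ n"
        using s U_nonneg[OF k] \<open>B \<ge> 0\<close> by (intro mult_left_mono power_mono) auto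
      finally show "\<bar>?f s\<bar> \<le> U * (B * (real (card A) * U * t) ^ n)"
        unfolding abs_mult using u_bound[OF k, of s] U_nonneg[OF k] by (intro mult_mono) auto
    qed
    ultimately show ?thesis by simp
  qed
  have "\<bar>\<phi> (x t) - expansion (Suc n) \<phi> t\<bar> = \<bar>\<Sum>k\<in>A. integral {0..t} (\<lambda>s. u k s * lie_deriv (G k) \<phi> (x s)) - integral {0..t} (\<lambda>s. u k s * expansion n (lie_deriv (G k) \<phi>) s)\<bar>"
    unfolding expansion_Suc[OF Suc.prems(3)] chain_rule_integral[OF \<phi>1 Suc.prems(3)] sum_subtractf by simp
  also have "\<dots> \<le> (\<Sum>k\<in>A. U * (B * (real (card A) * U * t) ^ n) * t)"
    by (rule order_trans[OF sum_abs sum_mono[OF bd]])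
  also have "\<dots> = B * (real (card A) * U * t) ^ Suc n" by simp
  finally show ?case .
qed

end

text \<open>The identity is the observable. A nonempty word of length \<open>j \<le> m\<close> has
  class C^(m - j + 1), hence at least C^1, as the iterated chain rule demands.\<close>

lemma chen_fliess_remainder:
  assumes "bounded_input_trajectory {1..m} u U D G p q T x0 x"
    and "T \<ge> 0" and "B \<ge> 0"
    and G: "\<And>k. k \<in> {1..m} \<Longrightarrow> Cn_on m D (G k)"
    and B: "\<And>ks y. set ks \<subseteq> {1..m} \<Longrightarrow> length ks = Suc m \<Longrightarrow> y \<in> {p..q} \<Longrightarrow> \<bar>iterated_lie_deriv G ks y\<bar> \<le> B"
  shows "\<bar>x T - x0 - chen_fliess_sum m G u x0 T\<bar> \<le> B * (real m * U * T) ^ Suc m"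
proof -
  interpret bounded_input_trajectory "{1..m}" u U D G p q T x0 x by fact
  let ?S = "\<lambda>l. {ks. set ks \<subseteq> {1..m} \<and> length ks = l}"
  have itl: "iter_lie (\<lambda>y. y) ks = iterated_lie_deriv G ks" if "ks \<noteq> []" for ks
    using that by (cases ks) (auto simp: iterated_lie_deriv_def)
  have "\<bar>x T - expansion (Suc m) (\<lambda>y. y) T\<bar> \<le> B * (real (card {1..m}) * U * T) ^ Suc m"
  proof (rule expansion_remainder[OF \<open>B \<ge> 0\<close>])
    fix ks assume ks: "set ks \<subseteq> {1..m}"
    show "Cn_on 1 D (iter_lie (\<lambda>y. y) ks)" if "length ks < Suc m"
    proof (cases ks)
      case Nil
      have "deriv (\<lambda>y::real. y) = (\<lambda>y. 1)" by (auto intro!: DERIV_imp_deriv DERIV_ident)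
      then show ?thesis using Nil Cn_on_Suc[of 0 D "\<lambda>y. y"] by simp
    next
      case (Cons k ks')
      have "Cn_on (m - length ks') D (iter_lie (G k) ks')"
        by (rule Cn_on_foldl_lie_deriv[OF open_D, of "{1..m}"]) (use that ks Cons G in auto)
      then have "Cn_on 1 D (iter_lie (G k) ks')"
        by (rule Cn_on_mono) (use that Cons in simp)
      then show ?thesis using Cons by simp
    qed
    show "\<bar>iter_lie (\<lambda>y. y) ks y\<bar> \<le> B" if "length ks = Suc m" "y \<in> {p..q}" for y
    proof -
      have "ks \<noteq> []" using that(1) by auto
      then show ?thesis using B[OF ks that] itl[of ks] by simp
    qed
  qed (use \<open>T \<ge> 0\<close> in auto)
  moreover have "expansion (Suc m) (\<lambda>y. y) T = x0 + chen_fliess_sum m G u x0 T"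
  proof -
    have S0: "?S 0 = {[]}" by auto
    have "expansion (Suc m) (\<lambda>y. y) T = (\<Sum>l<Suc m. \<Sum>ks\<in>?S l. iter_lie (\<lambda>y. y) ks x0 * iterated_integral u ks T)"
      unfolding expansion_def ..
    also have "\<dots> = x0 + (\<Sum>l=1..m. \<Sum>ks\<in>?S l. iter_lie (\<lambda>y. y) ks x0 * iterated_integral u ks T)"
      unfolding sum.lessThan_Suc_shift S0 by (simp add: sum.atLeast1_atMost_eq)
    also have "(\<Sum>l=1..m. \<Sum>ks\<in>?S l. iter_lie (\<lambda>y. y) ks x0 * iterated_integral u ks T)
        = chen_fliess_sum m G u x0 T"
      unfolding chen_fliess_sum_def
    proof (intro sum.cong refl)
      fix l ks assume "l \<in> {1..m}" "ks \<in> ?S l"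
      then have "ks \<noteq> []" by auto
      then show "iter_lie (\<lambda>y. y) ks x0 * iterated_integral u ks T = iterated_lie_deriv G ks x0 * iterated_integral u ks T"
        by (simp add: itl)
    qed
    finally show ?thesis .
  qed
  ultimately show ?thesis by (simp add: algebra_simps)
qed

section \<open>Caratheodory solutions for bounded measurable inputs\<close>

text \<open>
  In the norm weighted by \<open>exp (2 * K * t)\<close>, integration of a \<open>K\<close>-Lipschitz velocity contracts by \<open>1 / 2\<close>
  on the whole half-line.
\<close>

lemma integral_exp_bound:
  fixes f :: "real \<Rightarrow> real"
  assumes "t \<ge> 0" "K > 0" "C \<ge> 0" "f integrable_on {0..t}"
    and "\<And>s. s \<in> {0..t} \<Longrightarrow> \<bar>f s\<bar> \<le> K * (C * exp (2 * K * s))"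
  shows "\<bar>integral {0..t} f\<bar> \<le> C / 2 * exp (2 * K * t)"
proof -
  have E: "((\<lambda>s. K * (C * exp (2 * K * s))) has_integral C / 2 * exp (2 * K * t) - C / 2 * exp (2 * K * 0)) {0..t}"
    by (rule fundamental_theorem_of_calculus)
       (use assms(1,2) in \<open>auto intro!: derivative_eq_intros simp: has_real_derivative_iff_has_vector_derivative[symmetric]\<close>)
  have "norm (integral {0..t} f) \<le> integral {0..t} (\<lambda>s. K * (C * exp (2 * K * s)))"
    by (rule integral_norm_bound_integral[OF assms(4) has_integral_integrable[OF E]]) (use assms(5) in simp)
  also have "\<dots> = C / 2 * exp (2 * K * t) - C / 2 * exp (2 * K * 0)"
    using E by (rule integral_unique)
  finally show ?thesis using assms(3) by simp
qed

text \<open>Each pass through the integral equation halves the constant in front of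
  \<open>exp (2 * K * t)\<close>; starting from the maximum of \<open>z\<close>, the constant tends
  to 0.\<close>

lemma gronwall_zero:
  fixes z f :: "real \<Rightarrow> real"
  assumes "K > 0" "continuous_on {0..T} z"
    and "\<And>t. t \<in> {0..T} \<Longrightarrow> f integrable_on {0..t}"
    and "\<And>t. t \<in> {0..T} \<Longrightarrow> z t = integral {0..t} f"
    and "\<And>t. t \<in> {0..T} \<Longrightarrow> \<bar>f t\<bar> \<le> K * \<bar>z t\<bar>"
    and t: "t \<in> {0..T}"
  shows "z t = 0"
proof -
  have "compact (z ` {0..T})" by (rule compact_continuous_image[OF assms(2)]) auto
  then obtain S where S: "\<And>s. s \<in> {0..T} \<Longrightarrow> \<bar>z s\<bar> \<le> S"
    using compact_imp_bounded bounded_iff by (metis imageI real_norm_def)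
  have "S \<ge> 0" using S[OF t] by linarith
  have "\<bar>z s\<bar> \<le> S / 2 ^ n * exp (2 * K * s)" if "s \<in> {0..T}" for n s
    using that
  proof (induction n arbitrary: s)
    case 0
    have "S * 1 \<le> S * exp (2 * K * s)" using \<open>S \<ge> 0\<close> 0 assms(1) by (intro mult_left_mono) auto
    then show ?case using S[OF 0] by simp
  next
    case (Suc n)
    have "\<bar>integral {0..s} f\<bar> \<le> (S / 2 ^ n) / 2 * exp (2 * K * s)"
    proof (rule integral_exp_bound)
      fix r assume "r \<in> {0..s}"
      then have r: "r \<in> {0..T}" using Suc.prems by auto
      show "\<bar>f r\<bar> \<le> K * (S / 2 ^ n * exp (2 * K * r))"
        by (rule order_trans[OF assms(5)[OF r]], rule mult_left_mono[OF Suc.IH[OF r]]) (use assms(1) in simp)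
    qed (use assms(1,3) Suc.prems \<open>S \<ge> 0\<close> in auto)
    then show ?case using assms(4)[OF Suc.prems] by simp
  qed
  then have "\<And>n. \<bar>z t\<bar> \<le> S / 2 ^ n * exp (2 * K * t)" using t by blast
  moreover have "(\<lambda>n. S / 2 ^ n * exp (2 * K * t)) \<longlonglongrightarrow> 0 * exp (2 * K * t)"
    by (intro tendsto_mult tendsto_const LIMSEQ_divide_realpow_zero) simp
  ultimately have "\<bar>z t\<bar> \<le> 0 * exp (2 * K * t)"
    by (intro LIMSEQ_le_const) auto
  then show ?thesis by simp
qed

lemma AE_lebesgue_negligible:
  assumes "AE t in lebesgue. P t"
  obtains N where "negligible N" "\<And>t. t \<notin> N \<Longrightarrow> P t"
  using assms unfolding eventually_ae_filter negligible_iff_null_sets by auto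

lemma integral_equation_lipschitz:
  assumes "\<And>t. t \<ge> 0 \<Longrightarrow> f integrable_on {0..t}"
    and "\<And>t. t \<ge> 0 \<Longrightarrow> x t = x0 + integral {0..t} f"
    and "\<And>t. t \<ge> 0 \<Longrightarrow> \<bar>f t\<bar> \<le> M"
    and "a \<ge> 0" "b \<ge> 0"
  shows "\<bar>x b - x a\<bar> \<le> M * \<bar>b - (a::real)\<bar>"
proof -
  have *: "\<bar>x b - x a\<bar> \<le> M * \<bar>b - a\<bar>" if "0 \<le> a" "a \<le> b" for a b
  proof -
    have "x b - x a = integral {a..b} f"
      using assms(1)[of b] assms(2)[of a] assms(2)[of b] that
        Henstock_Kurzweil_Integration.integral_combine[of 0 a b f] by simp
    moreover have "f integrable_on {a..b}"
      using assms(1)[of b] that by (rule_tac integrable_on_subinterval[of f "{0..b}"]) auto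
    then have "\<bar>integral {a..b} f\<bar> \<le> M * (b - a)"
      using assms(3) that by (intro abs_integral_le) auto
    ultimately show ?thesis using that by simp
  qed
  show ?thesis using *[of a b] *[of b a] assms(4,5) by (cases "a \<le> b") (auto simp: abs_minus_commute)
qed

context bounded_input
begin

definition velocity :: "(nat \<Rightarrow> real \<Rightarrow> real) \<Rightarrow> real \<Rightarrow> real \<Rightarrow> real" where
  "velocity h t y = (\<Sum>k\<in>A. u k t * h k y)"

lemma velocity_bound:
  assumes "\<And>k. k \<in> A \<Longrightarrow> \<bar>h k y\<bar> \<le> H"
  shows "\<bar>velocity h t y\<bar> \<le> real (card A) * (U * H)"
proof -
  have "\<bar>velocity h t y\<bar> \<le> (\<Sum>k\<in>A. U * H)"
    unfolding velocity_def
  proof (rule order_trans[OF sum_abs sum_mono])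
    show "\<bar>u k t * h k y\<bar> \<le> U * H" if "k \<in> A" for k
      unfolding abs_mult using assms[OF that] u_bound[OF that] U_nonneg[OF that] by (intro mult_mono) auto
  qed
  then show ?thesis by simp
qed

lemma velocity_lipschitz:
  assumes "\<And>k. k \<in> A \<Longrightarrow> \<bar>h k y - h k z\<bar> \<le> L * \<bar>y - z\<bar>"
  shows "\<bar>velocity h t y - velocity h t z\<bar> \<le> real (card A) * U * L * \<bar>y - z\<bar>"
proof -
  have "velocity h t y - velocity h t z = velocity (\<lambda>k w. h k y - h k z) t 0"
    by (simp add: velocity_def sum_subtractf right_diff_distrib)
  then show ?thesis
    using velocity_bound[of "\<lambda>k w. h k y - h k z" 0 "L * \<bar>y - z\<bar>" t] assms by (simp add: mult.assoc)
qed

lemma velocity_integrable: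
  assumes "\<And>k. k \<in> A \<Longrightarrow> continuous_on D (h k)" "continuous_on {0..T} y" "y ` {0..T} \<subseteq> D" "t \<le> T"
  shows "(\<lambda>s. velocity h s (y s)) integrable_on {0..t}"
  unfolding velocity_def
proof (rule integrable_sum[OF finite_A])
  show "(\<lambda>s. u k s * h k (y s)) integrable_on {0..t}" if "k \<in> A" for k
    by (rule integrable_input_mult[OF that continuous_on_compose2[OF assms(1)[OF that] assms(2,3)] assms(4)])
qed

text \<open>A global Lipschitz constant lets the weighted iteration converge on the whole half-line
  at once. The bound \<open>H\<close> controls the first increment and dominates the velocities in
  the limit.\<close>

lemma picard_existence:
  assumes lip: "\<And>k y z. k \<in> A \<Longrightarrow> \<bar>h k y - h k z\<bar> \<le> L * \<bar>y - z\<bar>"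
    and bd: "\<And>k y. k \<in> A \<Longrightarrow> \<bar>h k y\<bar> \<le> H"
  obtains x where "\<And>t. t \<ge> 0 \<Longrightarrow> (\<lambda>s. velocity h s (x s)) integrable_on {0..t}"
    "\<And>t. t \<ge> 0 \<Longrightarrow> x t = x0 + integral {0..t} (\<lambda>s. velocity h s (x s))"
proof -
  \<comment> \<open>The summand 1 keeps \<open>K\<close> positive when the Lipschitz constant
    vanishes, since \<open>K\<close> appears in a denominator.\<close>
  define K where "K = \<bar>real (card A) * U * L\<bar> + 1"
  define M where "M = \<bar>real (card A) * (U * H)\<bar>"
  have K: "K > 0" "\<bar>velocity h t y - velocity h t z\<bar> \<le> K * \<bar>y - z\<bar>" for t y z
  proof -
    show "K > 0" by (simp add: K_def)
    have "\<bar>velocity h t y - velocity h t z\<bar> \<le> real (card A) * U * L * \<bar>y - z\<bar>"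
      using lip by (rule velocity_lipschitz)
    also have "\<dots> \<le> K * \<bar>y - z\<bar>" by (intro mult_right_mono) (auto simp: K_def)
    finally show "\<bar>velocity h t y - velocity h t z\<bar> \<le> K * \<bar>y - z\<bar>" .
  qed
  have M: "M \<ge> 0" "\<bar>velocity h t y\<bar> \<le> M" for t y
  proof -
    have "\<bar>velocity h t y\<bar> \<le> real (card A) * (U * H)" using bd by (rule velocity_bound)
    then show "M \<ge> 0" "\<bar>velocity h t y\<bar> \<le> M" by (simp_all add: M_def)
  qed
  have hc: "continuous_on UNIV (h k)" if "k \<in> A" for k
  proof (rule lipschitz_on_continuous_on[of "\<bar>L\<bar>"], rule lipschitz_onI)
    fix y z
    show "dist (h k y) (h k z) \<le> \<bar>L\<bar> * dist y z"
      using order_trans[OF lip[OF that, of y z] mult_right_mono[OF abs_ge_self abs_ge_zero]]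
      by (simp add: dist_real_def)
  qed auto
  have vi: "(\<lambda>s. velocity h s (y s)) integrable_on {0..t}" if "continuous_on {0..t} y" for y t
    by (rule velocity_integrable[OF hc that]) auto
  define X where "X = rec_nat (\<lambda>t. x0) (\<lambda>n y t. x0 + integral {0..t} (\<lambda>s. velocity h s (y s)))"
  have X0: "X 0 = (\<lambda>t. x0)" and XS: "X (Suc n) = (\<lambda>t. x0 + integral {0..t} (\<lambda>s. velocity h s (X n s)))" for n
    by (simp_all add: X_def)
  have Xc: "continuous_on {0..t} (X n)" for n t
  proof (induction n)
    case (Suc n)
    show ?case unfolding XS by (intro continuous_intros indefinite_integral_continuous_1 vi Suc)
  qed (simp add: X0)
  have step: "\<bar>X (Suc n) t - X n t\<bar> \<le> M / K / 2 ^ n * exp (2 * K * t)" if "t \<ge> 0" for n t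
    using that
  proof (induction n arbitrary: t)
    case 0
    have "\<bar>X (Suc 0) t - X 0 t\<bar> \<le> M * (t - 0)"
      unfolding XS X0 add_diff_cancel_left' by (rule abs_integral_le[OF 0 vi]) (use M in auto)
    \<comment> \<open>The first increment grows linearly; \<open>K * t \<le> exp (2 * K * t)\<close>
      fits it under the exponential weight, whence the constant \<open>M / K\<close>.\<close>
    also have "\<dots> = M / K * (K * t)" using K(1) by simp
    also have "\<dots> \<le> M / K * exp (2 * K * t)"
    proof (rule mult_left_mono)
      have "0 \<le> K * t" using 0 K(1) by simp
      then show "K * t \<le> exp (2 * K * t)" using exp_ge_add_one_self[of "2 * K * t"] by linarith
    qed (use M(1) K(1) in simp)
    finally show ?case by simp
  next
    case (Suc n)
    have "X (Suc (Suc n)) t - X (Suc n) t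
        = integral {0..t} (\<lambda>s. velocity h s (X (Suc n) s) - velocity h s (X n s))"
      using integral_diff[OF vi[OF Xc[of t "Suc n"]] vi[OF Xc[of t n]]]
      by (simp only: XS[of "Suc n"] XS[of n] add_diff_cancel_left)
    moreover have "\<bar>integral {0..t} (\<lambda>s. velocity h s (X (Suc n) s) - velocity h s (X n s))\<bar>
        \<le> (M / K / 2 ^ n) / 2 * exp (2 * K * t)"
    proof (rule integral_exp_bound)
      fix s assume s: "s \<in> {0..t}"
      have "\<bar>velocity h s (X (Suc n) s) - velocity h s (X n s)\<bar> \<le> K * \<bar>X (Suc n) s - X n s\<bar>" by (rule K)
      also have "\<dots> \<le> K * (M / K / 2 ^ n * exp (2 * K * s))"
        using s K(1) by (intro mult_left_mono Suc.IH) auto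
      finally show "\<bar>velocity h s (X (Suc n) s) - velocity h s (X n s)\<bar> \<le> K * (M / K / 2 ^ n * exp (2 * K * s))" .
    qed (use Suc.prems K(1) M(1) in \<open>auto intro!: integrable_diff vi Xc\<close>)
    ultimately show ?case by (simp add: mult_ac)
  qed
  have conv: "convergent (\<lambda>n. X n t)" if "t \<ge> 0" for t
  proof -
    have "summable (\<lambda>n. X (Suc n) t - X n t)"
    proof (rule summable_comparison_test[OF exI[of _ 0]])
      show "\<forall>n\<ge>0. norm (X (Suc n) t - X n t) \<le> M / K * exp (2 * K * t) * (1 / 2) ^ n"
        using step[OF that] by (simp add: power_divide mult_ac)
      show "summable (\<lambda>n. M / K * exp (2 * K * t) * (1 / 2) ^ n)"
        by (intro summable_mult summable_geometric) simp
    qed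
    then have "convergent (\<lambda>n. \<Sum>i<n. X (Suc i) t - X i t)"
      by (simp add: summable_iff_convergent)
    then have "convergent (\<lambda>n. X n t - x0)" using sum_lessThan_telescope[of "\<lambda>n. X n t"] by (simp add: X0)
    then show ?thesis using convergent_diff_const_right_iff by blast
  qed
  define x where "x t = lim (\<lambda>n. X n t)" for t
  have lim: "(\<lambda>n. X n t) \<longlonglongrightarrow> x t" if "t \<ge> 0" for t
    unfolding x_def using conv[OF that] by (simp add: convergent_LIMSEQ_iff)
  have limv: "(\<lambda>n. velocity h s (X n s)) \<longlonglongrightarrow> velocity h s (x s)" if "s \<ge> 0" for s
  proof -
    have "(\<lambda>n. K * \<bar>X n s - x s\<bar>) \<longlonglongrightarrow> K * \<bar>x s - x s\<bar>"
      by (intro tendsto_intros lim that)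
    then have "(\<lambda>n. K * \<bar>X n s - x s\<bar>) \<longlonglongrightarrow> 0" by simp
    then have "(\<lambda>n. velocity h s (X n s) - velocity h s (x s)) \<longlonglongrightarrow> 0"
      by (rule Lim_null_comparison[rotated]) (use K in auto)
    then show "(\<lambda>n. velocity h s (X n s)) \<longlonglongrightarrow> velocity h s (x s)" by (simp add: LIM_zero_iff)
  qed
  \<comment> \<open>Dominated convergence with the constant \<open>M\<close> also supplies the
    integrability of the limiting velocity.\<close>
  have dct: "(\<lambda>s. velocity h s (x s)) integrable_on {0..t}"
    "(\<lambda>n. integral {0..t} (\<lambda>s. velocity h s (X n s))) \<longlonglongrightarrow> integral {0..t} (\<lambda>s. velocity h s (x s))" for t
    using dominated_convergence[of "\<lambda>n s. velocity h s (X n s)" "{0..t}" "\<lambda>_. M" "\<lambda>s. velocity h s (x s)"]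
      vi[OF Xc] M limv by auto
  have "x t = x0 + integral {0..t} (\<lambda>s. velocity h s (x s))" if "t \<ge> 0" for t
  proof (rule LIMSEQ_unique)
    show "(\<lambda>n. X (Suc n) t) \<longlonglongrightarrow> x t" using lim[OF that] by (rule LIMSEQ_Suc)
    show "(\<lambda>n. X (Suc n) t) \<longlonglongrightarrow> x0 + integral {0..t} (\<lambda>s. velocity h s (x s))"
      unfolding XS by (intro tendsto_intros dct)
  qed
  with dct(1) show ?thesis using that by blast
qed

section \<open>Integral equations versus Caratheodory solutions, and uniqueness\<close>

lemma integral_equation_imp_caratheodory:
  assumes fi: "\<And>t. t \<ge> 0 \<Longrightarrow> (\<lambda>s. velocity h s (x s)) integrable_on {0..t}"
    and eq: "\<And>t. t \<ge> 0 \<Longrightarrow> x t = x0 + integral {0..t} (\<lambda>s. velocity h s (x s))"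
    and bd: "\<And>t. t \<ge> 0 \<Longrightarrow> \<bar>velocity h t (x t)\<bar> \<le> M"
    and D: "\<And>t. t \<ge> 0 \<Longrightarrow> x t \<in> D"
  shows "caratheodory_solution (velocity h) D {0..} x"
  unfolding caratheodory_solution_def
proof (intro conjI allI impI)
  show "\<forall>t\<in>{0..}. x t \<in> D" using D by auto
  fix a b :: real assume "{a..b} \<subseteq> {0..}"
  then show "absolutely_continuous_Icc a b x"
    by (intro lipschitz_imp_absolutely_continuous_Icc[of a b x M] integral_equation_lipschitz[OF fi eq bd]) auto
next
  let ?f = "\<lambda>s. velocity h s (x s)"
  \<comment> \<open>Differentiation is available on compact intervals; the exceptional sets for
    \<open>{0..n}\<close> are countably many, so their union is still null.\<close>
  have "\<exists>N. negligible N \<and> (\<forall>t\<in>{0..real n} - N. ((\<lambda>s. integral {0..s} ?f) has_real_derivative ?f t) (at t))" for n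
    using lebesgue_differentiation[OF fi, of "real n"] by (metis of_nat_0_le_iff)
  then obtain N where N: "\<And>n. negligible (N n)"
    "\<And>n t. t \<in> {0..real n} - N n \<Longrightarrow> ((\<lambda>s. integral {0..s} ?f) has_real_derivative ?f t) (at t)"
    by metis
  have "negligible (\<Union>(range N))" by (rule negligible_countable_Union) (use N(1) in auto)
  then have "AE t in lebesgue. t \<notin> \<Union>(range N)"
    unfolding negligible_iff_null_sets by (rule AE_not_in)
  then show "AE t in lebesgue. t \<in> {0..} \<longrightarrow> (x has_real_derivative velocity h t (x t)) (at t within {0..})"
  proof (rule AE_mp, intro AE_I2 impI)
    fix t :: real assume t: "t \<notin> \<Union>(range N)" "t \<in> {0..}"
    obtain n where "t \<le> real n" using real_arch_simple by blast
    then have "((\<lambda>s. x0 + integral {0..s} ?f) has_real_derivative 0 + ?f t) (at t within {0..})"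
      using t by (intro DERIV_add DERIV_const has_field_derivative_at_within[OF N(2)[of t n]]) auto
    then show "(x has_real_derivative velocity h t (x t)) (at t within {0..})"
      unfolding add_0 by (rule has_field_derivative_transform_within[OF _ zero_less_one])
         (use t eq in auto)
  qed
qed

text \<open>On the compact time interval the continuous path keeps each field bounded, which bounds
  the velocity as the fundamental theorem requires.\<close>

lemma caratheodory_imp_integral_equation:
  assumes hc: "\<And>k. k \<in> A \<Longrightarrow> continuous_on D (h k)"
    and sol: "caratheodory_solution (velocity h) D I x" and I: "{0..t} \<subseteq> I" and "t \<ge> 0"
  shows "continuous_on {0..t} x" "x t = x 0 + integral {0..t} (\<lambda>s. velocity h s (x s))"
proof -
  have ac: "absolutely_continuous_Icc 0 t x" and D: "x ` {0..t} \<subseteq> D"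
    and ae: "AE s in lebesgue. s \<in> I \<longrightarrow> (x has_real_derivative velocity h s (x s)) (at s within I)"
    using sol I unfolding caratheodory_solution_def by blast+
  show c: "continuous_on {0..t} x" by (rule absolutely_continuous_Icc_imp_continuous_on[OF ac])
  have "\<exists>B. \<forall>s\<in>{0..t}. \<bar>h k (x s)\<bar> \<le> B" if "k \<in> A" for k
  proof -
    have "compact ((\<lambda>s. h k (x s)) ` {0..t})"
      by (rule compact_continuous_image[OF continuous_on_compose2[OF hc[OF that] c D]]) auto
    then show ?thesis using compact_imp_bounded bounded_iff by (metis imageI real_norm_def)
  qed
  then obtain B where B: "\<And>k s. k \<in> A \<Longrightarrow> s \<in> {0..t} \<Longrightarrow> \<bar>h k (x s)\<bar> \<le> B k" by metis
  have BH: "\<bar>h k (x s)\<bar> \<le> (\<Sum>j\<in>A. \<bar>B j\<bar>)" if "k \<in> A" "s \<in> {0..t}" for k s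
    using B[OF that] member_le_sum[of k A "\<lambda>j. \<bar>B j\<bar>"] finite_A that by fastforce
  obtain N where N: "negligible N"
    "\<And>s. s \<notin> N \<Longrightarrow> s \<in> I \<Longrightarrow> (x has_real_derivative velocity h s (x s)) (at s within I)"
    using AE_lebesgue_negligible[OF ae] by blast
  have "x t - x 0 = integral {0..t} (\<lambda>s. velocity h s (x s))"
  proof (rule absolutely_continuous_Icc_eq_integral[OF \<open>t \<ge> 0\<close> ac])
    show "negligible N" by (rule N(1))
    show "(x has_real_derivative velocity h s (x s)) (at s within {0..t})" if "s \<in> {0..t} - N" for s
      by (rule DERIV_subset[OF N(2) I]) (use that I in auto)
    show "(\<lambda>s. velocity h s (x s)) integrable_on {0..t}"
      by (rule velocity_integrable[OF hc c D]) auto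
    show "\<bar>velocity h s (x s)\<bar> \<le> real (card A) * (U * (\<Sum>j\<in>A. \<bar>B j\<bar>))" if "s \<in> {0..t}" for s
      using BH that by (intro velocity_bound) auto
  qed
  then show "x t = x 0 + integral {0..t} (\<lambda>s. velocity h s (x s))" by simp
qed

text \<open>Up to time \<open>T\<close> both paths fill compact sets; as \<open>D\<close> is an
  interval, it contains the compact interval spanned by them. There the fields share a Lipschitz
  constant, and the Gronwall argument annihilates the difference.\<close>

lemma caratheodory_unique:
  assumes "is_interval D" and h: "\<And>k. k \<in> A \<Longrightarrow> Cn_on 1 D (h k)"
    and x: "caratheodory_solution (velocity h) D I x" and y: "caratheodory_solution (velocity h) D I' y"
    and "x 0 = y 0" "{0..T} \<subseteq> I" "{0..T} \<subseteq> I'" "T \<ge> 0"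
  shows "x T = y T"
proof -
  have hc: "continuous_on D (h k)" if "k \<in> A" for k
    using Cn_on_mono[OF h[OF that], of 0] by simp
  have sub: "{0..t} \<subseteq> I" "{0..t} \<subseteq> I'" if "t \<in> {0..T}" for t using that assms(6,7) by auto
  have xc: "continuous_on {0..T} x" and yc: "continuous_on {0..T} y"
    using caratheodory_imp_integral_equation(1)[OF hc x assms(6,8)]
      caratheodory_imp_integral_equation(1)[OF hc y assms(7,8)] by simp_all
  have xD: "x ` {0..T} \<subseteq> D" and yD: "y ` {0..T} \<subseteq> D"
    using x y assms(6,7) unfolding caratheodory_solution_def by blast+
  define S where "S = x ` {0..T} \<union> y ` {0..T}"
  have "compact S" "S \<noteq> {}" "S \<subseteq> D"
    using compact_continuous_image[OF xc] compact_continuous_image[OF yc] xD yD \<open>T \<ge> 0\<close> by (auto simp: S_def)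
  then obtain p q where pq: "p \<in> S" "q \<in> S" "S \<subseteq> {p..q}"
    by (metis atLeastAtMost_iff compact_attains_inf compact_attains_sup subsetI)
  then have pqD: "{p..q} \<subseteq> D"
    using \<open>is_interval D\<close> \<open>S \<subseteq> D\<close> by (meson atLeastAtMost_iff mem_is_interval_1_I subsetD subsetI)
  have "\<exists>L. \<forall>a\<in>{p..q}. \<forall>b\<in>{p..q}. \<bar>h k a - h k b\<bar> \<le> L * \<bar>a - b\<bar>" if "k \<in> A" for k
    using Cn_on_1_lipschitz[OF h[OF that] pqD] by metis
  then obtain L where L: "\<And>k a b. k \<in> A \<Longrightarrow> a \<in> {p..q} \<Longrightarrow> b \<in> {p..q} \<Longrightarrow> \<bar>h k a - h k b\<bar> \<le> L k * \<bar>a - b\<bar>"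
    by metis
  define L' where "L' = (\<Sum>j\<in>A. \<bar>L j\<bar>)"
  have L': "\<bar>h k a - h k b\<bar> \<le> L' * \<bar>a - b\<bar>" if "k \<in> A" "a \<in> {p..q}" "b \<in> {p..q}" for k a b
  proof (rule order_trans[OF L[OF that]], rule mult_right_mono)
    show "L k \<le> L'" unfolding L'_def using member_le_sum[of k A "\<lambda>j. \<bar>L j\<bar>"] finite_A that(1) by fastforce
  qed simp
  define K where "K = \<bar>real (card A) * U * L'\<bar> + 1"
  have vi: "(\<lambda>s. velocity h s (x s)) integrable_on {0..t}" "(\<lambda>s. velocity h s (y s)) integrable_on {0..t}" if "t \<in> {0..T}" for t
    using velocity_integrable[OF hc xc xD] velocity_integrable[OF hc yc yD] that by auto
  have "x T - y T = 0"
  proof (rule gronwall_zero[where z = "\<lambda>t. x t - y t" and K = K and T = T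
        and f = "\<lambda>s. velocity h s (x s) - velocity h s (y s)"])
    fix t assume t: "t \<in> {0..T}"
    show "x t - y t = integral {0..t} (\<lambda>s. velocity h s (x s) - velocity h s (y s))"
      using caratheodory_imp_integral_equation(2)[OF hc x sub(1)[OF t]]
        caratheodory_imp_integral_equation(2)[OF hc y sub(2)[OF t]] \<open>x 0 = y 0\<close> t
        integral_diff[OF vi[OF t]] by simp
    have "x t \<in> S" "y t \<in> S" using t by (simp_all add: S_def)
    then have "x t \<in> {p..q}" "y t \<in> {p..q}" using pq(3) by blast+
    then have "\<bar>velocity h t (x t) - velocity h t (y t)\<bar> \<le> real (card A) * U * L' * \<bar>x t - y t\<bar>"
      using L' by (intro velocity_lipschitz) auto
    also have "\<dots> \<le> K * \<bar>x t - y t\<bar>" by (intro mult_right_mono) (auto simp: K_def)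
    finally show "\<bar>velocity h t (x t) - velocity h t (y t)\<bar> \<le> K * \<bar>x t - y t\<bar>" .
  qed (use vi xc yc \<open>T \<ge> 0\<close> in \<open>auto intro!: integrable_diff continuous_on_diff simp: K_def\<close>)
  then show ?thesis by simp
qed

end

text \<open>One null set of times has to serve all states, because the state inserted into
  \<open>F t\<close> moves with \<open>t\<close>.\<close>

lemma caratheodory_solution_cong_AE:
  assumes "AE t in lebesgue. \<forall>y. F t y = F' t y"
  shows "caratheodory_solution F D I x \<longleftrightarrow> caratheodory_solution F' D I x"
proof -
  have "(AE t in lebesgue. t \<in> I \<longrightarrow> (x has_real_derivative F t (x t)) (at t within I))
    \<longleftrightarrow> (AE t in lebesgue. t \<in> I \<longrightarrow> (x has_real_derivative F' t (x t)) (at t within I))"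
    by (rule iffI; rule AE_mp[OF _ AE_mp[OF assms]]) auto
  then show ?thesis by (simp add: caratheodory_solution_def)
qed

section \<open>Reduction to one period\<close>

text \<open>Inner integrals agree at every time, not just off \<open>N\<close>, so each level of the
  induction meets the same null set. This carries the excitation condition over to the truncated
  dithers.\<close>

lemma iterated_integral_cong_AE:
  assumes N: "negligible N" "\<And>k t. k \<in> set ks \<Longrightarrow> t \<notin> N \<Longrightarrow> u k t = u' k t"
    and u': "\<And>k. k \<in> set ks \<Longrightarrow> u' k \<in> borel_measurable lebesgue" "\<And>k t. k \<in> set ks \<Longrightarrow> \<bar>u' k t\<bar> \<le> U"
  shows "iterated_integral u ks t = iterated_integral u' ks t"
  using assms(2-)
proof (induction ks arbitrary: t)
  case (Cons k ks)
  have IH: "iterated_integral u ks = iterated_integral u' ks"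
    using Cons by (intro ext) auto
  have c: "continuous_on {0..t} (iterated_integral u' ks)"
    by (rule continuous_on_iterated_integral[where U = U]) (use Cons.prems in auto)
  have i': "(\<lambda>s. u' k s * iterated_integral u' ks s) absolutely_integrable_on {0..t}"
    by (rule continuous_mult_bounded_integrable[OF c, where U = U]) (use Cons.prems in auto)
  have eq: "u k s * iterated_integral u' ks s = u' k s * iterated_integral u' ks s" if "s \<in> {0..t} - N" for s
    using Cons.prems(1)[of k s] that by simp
  have i: "(\<lambda>s. u k s * iterated_integral u' ks s) absolutely_integrable_on {0..t}"
    by (rule absolutely_integrable_spike[OF i' N(1) eq])
  show ?case
    unfolding iterated_integral.simps IH set_lebesgue_integral_eq_integral(2)[OF i]
      set_lebesgue_integral_eq_integral(2)[OF i']
    by (rule integral_spike[OF N(1) eq[symmetric]])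
qed simp

lemma chen_fliess_sum_cong_AE:
  assumes "negligible N" "\<And>k t. k \<in> {1..m} \<Longrightarrow> t \<notin> N \<Longrightarrow> u k t = u' k t"
    and "\<And>k. k \<in> {1..m} \<Longrightarrow> u' k \<in> borel_measurable lebesgue" "\<And>k t. k \<in> {1..m} \<Longrightarrow> \<bar>u' k t\<bar> \<le> U"
  shows "chen_fliess_sum m G u y t = chen_fliess_sum m G u' y t"
  unfolding chen_fliess_sum_def
proof (intro sum.cong refl)
  fix l ks assume "ks \<in> {ks. set ks \<subseteq> {1..m} \<and> length ks = l}"
  then have "k \<in> {1..m}" if "k \<in> set ks" for k using that by auto
  then have "iterated_integral u ks t = iterated_integral u' ks t"
    using assms by (intro iterated_integral_cong_AE[where N = N and U = U]) blast+
  then show "iterated_lie_deriv G ks y * iterated_integral u ks t = iterated_lie_deriv G ks y * iterated_integral u' ks t"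
    by simp
qed

section \<open>Contraction at sample times and the period map\<close>

lemma perturbed_contraction:
  fixes y :: "nat \<Rightarrow> real"
  assumes s: "0 \<le> s" "s \<le> 1" and "0 \<le> \<sigma>" "\<sigma> < \<delta>" "y 0 < \<delta>"
    and step: "\<And>n. y n < \<delta> \<Longrightarrow> y (Suc n) \<le> (1 - s) * y n + s * \<sigma>"
  shows "y n < \<delta> \<and> y n \<le> (1 - s) ^ n * y 0 + \<sigma>"
proof (induction n)
  case 0
  then show ?case using assms by simp
next
  case (Suc n)
  have st: "y (Suc n) \<le> (1 - s) * y n + s * \<sigma>" using step Suc by blast
  \<comment> \<open>A convex combination of two numbers below \<delta>: this renews the guard of
    \<open>step\<close>, so the recursion never loses its domain of validity.\<close>
  have "(1 - s) * y n + s * \<sigma> < \<delta>"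
    using convex_bound_lt[of "y n" \<delta> \<sigma> "1 - s" s] Suc assms by simp
  moreover have "(1 - s) * y n + s * \<sigma> \<le> (1 - s) * ((1 - s) ^ n * y 0 + \<sigma>) + s * \<sigma>"
    using Suc s by (intro add_right_mono mult_left_mono) auto
  ultimately show ?case using st by (simp add: algebra_simps)
qed

text \<open>For \<open>e > 0\<close> the condition \<open>\<kappa> * \<beta>2 \<le> 1\<close>
  excludes overshooting, so the absolute value is \<open>e - \<kappa> * P\<close>, and coercivity
  bounds \<open>P\<close> below by \<open>\<beta>1 * e\<close>. Reflecting both \<open>e\<close> and
  \<open>P\<close> covers the other sign.\<close>

lemma gradient_step_contraction:
  fixes e P \<kappa> \<beta>1 \<beta>2 :: real
  assumes "P * e \<ge> \<beta>1 * \<bar>e\<bar> ^ 2" "\<bar>P\<bar> \<le> \<beta>2 * \<bar>e\<bar>" "\<kappa> \<ge> 0" "\<kappa> * \<beta>2 \<le> 1"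
  shows "\<bar>e - \<kappa> * P\<bar> \<le> (1 - \<kappa> * \<beta>1) * \<bar>e\<bar>"
proof -
  have main: "\<bar>e - \<kappa> * P\<bar> \<le> (1 - \<kappa> * \<beta>1) * e"
    if e: "e > 0" and 1: "P * e \<ge> \<beta>1 * e ^ 2" and 2: "\<bar>P\<bar> \<le> \<beta>2 * e" for e P :: real
  proof -
    have "\<beta>1 * e \<le> P" using 1 e by (simp add: power2_eq_square mult.assoc[symmetric])
    then have "\<kappa> * (\<beta>1 * e) \<le> \<kappa> * P" by (rule mult_left_mono) fact
    moreover have "\<kappa> * P \<le> e"
    proof -
      have "\<kappa> * P \<le> \<kappa> * (\<beta>2 * e)" using 2 assms(3) by (intro mult_left_mono) auto
      also have "\<dots> = (\<kappa> * \<beta>2) * e" by simp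
      also have "\<dots> \<le> 1 * e" using e assms(4) by (intro mult_right_mono) auto
      finally show ?thesis by simp
    qed
    ultimately show ?thesis by (simp add: algebra_simps)
  qed
  consider "e > 0" | "e = 0" | "e < 0" by linarith
  then show ?thesis
  proof cases
    case 1
    then show ?thesis using main[of e P] assms by simp
  next
    case 2
    then show ?thesis using assms by simp
  next
    case 3
    then show ?thesis using main[of "- e" "- P"] assms by (simp add: abs_minus_commute)
  qed
qed

text \<open>By periodicity of the input the shifted path solves the same equation from a new initial
  value, so every period can be treated as the first.\<close>

lemma (in bounded_input) periodic_shift:
  assumes per: "\<And>k t. k \<in> A \<Longrightarrow> u k (t + P) = u k t"
    and fi: "\<And>t. t \<ge> 0 \<Longrightarrow> (\<lambda>s. velocity h s (x s)) integrable_on {0..t}"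
    and eq: "\<And>t. t \<ge> 0 \<Longrightarrow> x t = x0 + integral {0..t} (\<lambda>s. velocity h s (x s))"
    and "P \<ge> 0" "t \<ge> 0"
  shows "x (real n * P + t) = x (real n * P) + integral {0..t} (\<lambda>s. velocity h s (x (real n * P + s)))"
proof -
  have pern: "u k (real n * P + s) = u k s" if "k \<in> A" for k s
  proof (induction n)
    case (Suc n)
    have "u k (real (Suc n) * P + s) = u k ((real n * P + s) + P)" by (simp add: algebra_simps)
    then show ?case using per[OF that] Suc by simp
  qed simp
  let ?f = "\<lambda>s. velocity h s (x s)"
  have "x (real n * P + t) = x (real n * P) + integral {real n * P..real n * P + t} ?f"
    using eq[of "real n * P"] eq[of "real n * P + t"] fi[of "real n * P + t"] assms(4,5)
      Henstock_Kurzweil_Integration.integral_combine[of 0 "real n * P" "real n * P + t" ?f] by simp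
  also have "integral {real n * P..real n * P + t} ?f = integral {0..t} (?f \<circ> (+) (real n * P))"
    using integral_shift_Icc_real[of 0 t ?f "real n * P"] by (simp add: add.commute)
  also have "\<dots> = integral {0..t} (\<lambda>s. velocity h s (x (real n * P + s)))"
    by (rule integral_cong) (simp add: velocity_def pern)
  finally show ?thesis .
qed

text \<open>The margin in \<open>start\<close> is the farthest the clipped solution can travel in
  one period. It hence stays where \<open>clip\<close> is the identity, is a trajectory of the
  original fields, and obeys the remainder estimate.\<close>

lemma clipped_period_map:
  fixes p q H :: real
  defines "clip \<equiv> \<lambda>y. max p (min q y)"
  assumes bi: "bounded_input {1..m} u U" and "open D" and pq: "{p..q} \<subseteq> D" and ple: "p \<le> q"
    and G: "\<And>k. k \<in> {1..m} \<Longrightarrow> Cn_on m D (G k)" and "m \<ge> 1"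
    and H: "\<And>k y. k \<in> {1..m} \<Longrightarrow> y \<in> {p..q} \<Longrightarrow> \<bar>G k y\<bar> \<le> H"
    and B: "\<And>ks y. set ks \<subseteq> {1..m} \<Longrightarrow> length ks = Suc m \<Longrightarrow> y \<in> {p..q} \<Longrightarrow> \<bar>iterated_lie_deriv G ks y\<bar> \<le> B"
    and "B \<ge> 0" and "P \<ge> 0"
    and per: "\<And>k t. k \<in> {1..m} \<Longrightarrow> u k (t + P) = u k t"
    and fi: "\<And>t. t \<ge> 0 \<Longrightarrow> (\<lambda>s. bounded_input.velocity {1..m} u (\<lambda>k y. G k (clip y)) s (x s)) integrable_on {0..t}"
    and eq: "\<And>t. t \<ge> 0 \<Longrightarrow> x t = x0 + integral {0..t} (\<lambda>s. bounded_input.velocity {1..m} u (\<lambda>k y. G k (clip y)) s (x s))"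
    and start: "p + real m * (U * H) * P \<le> x (real n * P)" "x (real n * P) \<le> q - real m * (U * H) * P"
  shows "\<And>t. t \<in> {0..P} \<Longrightarrow> \<bar>x (real n * P + t) - x (real n * P)\<bar> \<le> real m * (U * H) * P"
    and "\<bar>x (real n * P + P) - x (real n * P) - chen_fliess_sum m G u (x (real n * P)) P\<bar> \<le> B * (real m * U * P) ^ Suc m"
proof -
  interpret bounded_input "{1..m}" u U by fact
  have UH: "U * H \<ge> 0"
    using U_nonneg[of 1] H[of 1 p] ple \<open>m \<ge> 1\<close> by auto
  have clip: "clip y \<in> {p..q}" for y using ple by (auto simp: clip_def)
  let ?h = "\<lambda>k y. G k (clip y)"
  have vb: "\<bar>velocity ?h t y\<bar> \<le> real m * (U * H)" for t y
    using velocity_bound[of ?h y H t] H clip by simp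
  have lip: "\<bar>x b - x a\<bar> \<le> real m * (U * H) * \<bar>b - a\<bar>" if "a \<ge> 0" "b \<ge> 0" for a b
    using that by (intro integral_equation_lipschitz[OF fi eq vb])
  show move: "\<bar>x (real n * P + t) - x (real n * P)\<bar> \<le> real m * (U * H) * P" if "t \<in> {0..P}" for t
  proof -
    have "\<bar>x (real n * P + t) - x (real n * P)\<bar> \<le> real m * (U * H) * \<bar>t\<bar>"
      using lip[of "real n * P" "real n * P + t"] that \<open>P \<ge> 0\<close> by simp
    also have "\<dots> \<le> real m * (U * H) * P" using that UH by (intro mult_left_mono) auto
    finally show ?thesis .
  qed
  have range: "x (real n * P + t) \<in> {p..q}" if "t \<in> {0..P}" for t
    using move[OF that] start by auto
  have traj: "bounded_input_trajectory {1..m} u U D G p q P (x (real n * P)) (\<lambda>s. x (real n * P + s))"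
  proof unfold_locales
    show "Cn_on 1 D (G k)" if "k \<in> {1..m}" for k using Cn_on_mono[OF G[OF that] \<open>m \<ge> 1\<close>] .
    have "continuous_on {0..} x"
    proof (rule lipschitz_on_continuous_on, rule lipschitz_onI)
      show "dist (x a) (x b) \<le> real m * (U * H) * dist a b" if "a \<in> {0..}" "b \<in> {0..}" for a b
        using lip[of b a] that by (simp add: dist_real_def)
    qed (use UH in simp)
    then show "continuous_on {0..P} (\<lambda>s. x (real n * P + s))"
      by (rule continuous_on_compose2) (use \<open>P \<ge> 0\<close> in \<open>auto intro!: continuous_intros\<close>)
    fix t assume t: "t \<in> {0..P}"
    show "x (real n * P + t) \<in> {p..q}" by (rule range[OF t])
    have "x (real n * P + t) = x (real n * P) + integral {0..t} (\<lambda>s. velocity ?h s (x (real n * P + s)))"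
      using t \<open>P \<ge> 0\<close> by (intro periodic_shift[OF per fi eq]) auto
    also have "integral {0..t} (\<lambda>s. velocity ?h s (x (real n * P + s)))
        = integral {0..t} (\<lambda>s. \<Sum>k\<in>{1..m}. u k s * G k (x (real n * P + s)))"
    proof (rule integral_cong)
      fix s assume "s \<in> {0..t}"
      then have "x (real n * P + s) \<in> {p..q}" using t by (intro range) auto
      then have "clip (x (real n * P + s)) = x (real n * P + s)" by (auto simp: clip_def)
      then show "velocity ?h s (x (real n * P + s)) = (\<Sum>k\<in>{1..m}. u k s * G k (x (real n * P + s)))"
        unfolding velocity_def by simp
    qed
    finally show "x (real n * P + t) = x (real n * P) + integral {0..t} (\<lambda>s. \<Sum>k\<in>{1..m}. u k s * G k (x (real n * P + s)))" .
  qed (use \<open>open D\<close> pq in auto)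
  show "\<bar>x (real n * P + P) - x (real n * P) - chen_fliess_sum m G u (x (real n * P)) P\<bar> \<le> B * (real m * U * P) ^ Suc m"
    by (rule chen_fliess_remainder[OF traj \<open>P \<ge> 0\<close> \<open>B \<ge> 0\<close> G B])
qed


section \<open>Constants independent of \<epsilon>\<close>

lemma common_essential_bound:
  fixes v :: "'i \<Rightarrow> real \<Rightarrow> real"
  assumes "finite A" and bd: "\<And>k. k \<in> A \<Longrightarrow> \<exists>M. AE t in lebesgue. \<bar>v k t\<bar> \<le> M"
  shows "\<exists>V\<ge>0. AE t in lebesgue. \<forall>k\<in>A. \<bar>v k t\<bar> \<le> V"
proof -
  obtain M where M: "\<And>k. k \<in> A \<Longrightarrow> AE t in lebesgue. \<bar>v k t\<bar> \<le> M k" using bd by metis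
  define V where "V = (\<Sum>k\<in>A. \<bar>M k\<bar>)"
  have MV: "M k \<le> V" if "k \<in> A" for k
    using member_le_sum[of k A "\<lambda>k. \<bar>M k\<bar>"] that \<open>finite A\<close> unfolding V_def by fastforce
  have "AE t in lebesgue. \<bar>v k t\<bar> \<le> V" if "k \<in> A" for k
    using M[OF that] by eventually_elim (use MV[OF that] in linarith)
  then have "AE t in lebesgue. \<forall>k\<in>A. \<bar>v k t\<bar> \<le> V"
    using \<open>finite A\<close> by (simp add: AE_finite_all)
  then show ?thesis by (intro exI[of _ V]) (simp add: V_def sum_nonneg)
qed

text \<open>Openness leaves room beyond both end points of the closed ball, and convexity fills the
  gap. The room \<eta> accommodates the motion between sample times.\<close>

lemma interval_enlarge:
  fixes xs \<delta> :: real
  assumes "open D" "is_interval D" "\<delta> > 0" "closure (ball xs \<delta>) \<subseteq> D"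
  shows "\<exists>\<eta>>0. {xs - \<delta> - \<eta>..xs + \<delta> + \<eta>} \<subseteq> D"
proof -
  have "cball xs \<delta> \<subseteq> D" using assms(3,4) by simp
  then have "xs - \<delta> \<in> D" "xs + \<delta> \<in> D" using assms(3) by (auto simp: dist_real_def subset_iff)
  then obtain r1 r2 where r: "r1 > 0" "cball (xs - \<delta>) r1 \<subseteq> D" "r2 > 0" "cball (xs + \<delta>) r2 \<subseteq> D"
    using assms(1) open_contains_cball by metis
  define \<eta> where "\<eta> = min r1 r2"
  have "xs - \<delta> - \<eta> \<in> D" "xs + \<delta> + \<eta> \<in> D"
    using r by (auto simp: \<eta>_def dist_real_def subset_iff)
  then have "{xs - \<delta> - \<eta>..xs + \<delta> + \<eta>} \<subseteq> D"
    using assms(2) by (meson atLeastAtMost_iff mem_is_interval_1_I subsetI)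
  then show ?thesis using r by (intro exI[of _ \<eta>]) (simp add: \<eta>_def)
qed

lemma uniform_bound_on_Icc:
  fixes f :: "'i \<Rightarrow> real \<Rightarrow> real"
  assumes "finite S" "\<And>i. i \<in> S \<Longrightarrow> continuous_on {p..q} (f i)"
  shows "\<exists>B\<ge>0. \<forall>i\<in>S. \<forall>y\<in>{p..q}. \<bar>f i y\<bar> \<le> B"
proof -
  have "\<exists>b. \<forall>y\<in>{p..q}. \<bar>f i y\<bar> \<le> b" if "i \<in> S" for i
    using compact_imp_bounded[OF compact_continuous_image[OF assms(2)[OF that] compact_Icc]]
    unfolding bounded_iff by auto
  then obtain b where b: "\<And>i y. i \<in> S \<Longrightarrow> y \<in> {p..q} \<Longrightarrow> \<bar>f i y\<bar> \<le> b i" by metis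
  have "\<bar>f i y\<bar> \<le> (\<Sum>j\<in>S. \<bar>b j\<bar>)" if "i \<in> S" "y \<in> {p..q}" for i y
    using b[OF that] member_le_sum[of i S "\<lambda>j. \<bar>b j\<bar>"] that(1) \<open>finite S\<close> by fastforce
  then show ?thesis by (intro exI[of _ "\<Sum>j\<in>S. \<bar>b j\<bar>"]) (auto simp: sum_nonneg)
qed

section \<open>Semi-global practical exponential stability\<close>

theorem theorem2:
  fixes D :: "real set" and m :: nat and xs :: real
    and J :: "real \<Rightarrow> real" and g v :: "nat \<Rightarrow> real \<Rightarrow> real"
    and \<alpha>1 \<alpha>2 \<beta>1 \<beta>2 c :: real and I :: "nat list"
  assumes "open D" and "is_interval D" and "D \<noteq> {}"
    and "m \<ge> 2" and "xs \<in> D"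
    and "Cn_on m D J"
    and "\<alpha>1 > 0" and "\<alpha>2 > 0" and "\<beta>1 > 0" and "\<beta>2 > 0"
    and "\<And>x. x \<in> D \<Longrightarrow> \<alpha>1 * \<bar>x - xs\<bar> ^ m \<le> J x - J xs"
    and "\<And>x. x \<in> D \<Longrightarrow> J x - J xs \<le> \<alpha>2 * \<bar>x - xs\<bar> ^ m"
    and "\<And>x. x \<in> D \<Longrightarrow> (deriv ^^ (m - 1)) J x * (x - xs) \<ge> \<beta>1 * \<bar>x - xs\<bar> ^ 2"
    and "\<And>x. x \<in> D \<Longrightarrow> \<bar>(deriv ^^ (m - 1)) J x\<bar> \<le> \<beta>2 * \<bar>x - xs\<bar>"
    and "\<And>k. k \<in> {1..m} \<Longrightarrow> Cn_on m D (g k \<circ> J)"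
    and "length I = m" and "set I \<subseteq> {1..m}" and "c > 0"
    and "\<And>x. x \<in> D \<Longrightarrow> iterated_lie_bracket (\<lambda>k. g k \<circ> J) I x = - c * (deriv ^^ (m - 1)) J x"
    and "\<And>k t. k \<in> {1..m} \<Longrightarrow> v k (t + 1) = v k t"
    and "\<And>k. k \<in> {1..m} \<Longrightarrow> v k \<in> borel_measurable lebesgue"
    and "\<And>k. k \<in> {1..m} \<Longrightarrow> \<exists>M. AE t in lebesgue. \<bar>v k t\<bar> \<le> M"
    and "\<And>\<epsilon> x0. \<epsilon> > 0 \<Longrightarrow> x0 \<in> D \<Longrightarrow>
           chen_fliess_sum m (\<lambda>k. g k \<circ> J) (dither m v \<epsilon>) x0 \<epsilon>
             = \<epsilon> * iterated_lie_bracket (\<lambda>k. g k \<circ> J) I x0"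
  shows "semiglobally_practically_exp_stable
           (\<lambda>\<epsilon> t x. \<Sum>k=1..m. g k (J x) * dither m v \<epsilon> k t) D xs"
proof -
  define G where "G = (\<lambda>k. g k \<circ> J)"
  define dJ where "dJ = (deriv ^^ (m - 1)) J"
  note D = \<open>open D\<close> \<open>is_interval D\<close> \<open>xs \<in> D\<close>
  have GC: "Cn_on m D (G k)" if "k \<in> {1..m}" for k
    using assms(15)[OF that] by (simp add: G_def)
  have m1: "m \<ge> 1" using \<open>m \<ge> 2\<close> by simp
  have G1: "Cn_on 1 D (G k)" if "k \<in> {1..m}" for k
    using Cn_on_mono[OF GC[OF that] m1] .
  have Gc: "continuous_on D (G k)" if "k \<in> {1..m}" for k
    using Cn_on_mono[OF GC[OF that], of 0] by simp
  have "\<exists>V\<ge>0. AE t in lebesgue. \<forall>k\<in>{1..m}. \<bar>v k t\<bar> \<le> V"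
    by (rule common_essential_bound[OF finite_atLeastAtMost]) (rule assms(22))
  then obtain V where V: "V \<ge> 0" and AE_V: "AE t in lebesgue. \<forall>k\<in>{1..m}. \<bar>v k t\<bar> \<le> V"
    by blast
  obtain N where N: "negligible N" "\<And>t. t \<notin> N \<Longrightarrow> \<forall>k\<in>{1..m}. \<bar>v k t\<bar> \<le> V"
    using AE_lebesgue_negligible[OF AE_V] by metis
  \<comment> \<open>Truncation turns the essential bound into a pointwise one. It tests the value of
    \<open>v\<close>, not membership of \<open>t\<close> in \<open>N\<close>, and therefore
    preserves periodicity.\<close>
  define w where "w k t = (if \<bar>v k t\<bar> \<le> V then v k t else 0)" for k t
  have w_eq: "v k t = w k t" if "k \<in> {1..m}" "t \<notin> N" for k t
    using bspec[OF N(2)[OF that(2)] that(1)] by (simp add: w_def)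
  have w_bound: "\<bar>w k t\<bar> \<le> V" for k t
    using V by (simp add: w_def)
  have w_measurable: "w k \<in> borel_measurable lebesgue" if "k \<in> {1..m}" for k
  proof -
    have [measurable]: "v k \<in> borel_measurable lebesgue" by (rule assms(21)[OF that])
    have "{t \<in> space lebesgue. \<bar>v k t\<bar> \<le> V} \<in> sets lebesgue" by measurable
    then show ?thesis unfolding w_def[abs_def] by (intro measurable_If) auto
  qed
  have w_per: "w k (t + 1) = w k t" if "k \<in> {1..m}" for k t
    unfolding w_def assms(20)[OF that] ..
  show ?thesis
    unfolding semiglobally_practically_exp_stable_def
  proof (intro allI impI)
    fix \<delta> :: real assume \<delta>: "\<delta> > 0" "closure (ball xs \<delta>) \<subseteq> D"
    obtain \<eta> where \<eta>: "\<eta> > 0" "{xs - \<delta> - \<eta>..xs + \<delta> + \<eta>} \<subseteq> D"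
      using interval_enlarge[OF D(1,2) \<delta>] by blast
    define p where "p = xs - \<delta> - \<eta>"
    define q where "q = xs + \<delta> + \<eta>"
    have pq: "{p..q} \<subseteq> D" "p \<le> q" using \<eta> \<delta>(1) by (auto simp: p_def q_def)
    have "\<exists>H\<ge>0. \<forall>k\<in>{1..m}. \<forall>y\<in>{p..q}. \<bar>G k y\<bar> \<le> H"
      by (rule uniform_bound_on_Icc[OF finite_atLeastAtMost]) (rule continuous_on_subset[OF Gc pq(1)])
    then obtain H where H: "H \<ge> 0" "\<And>k y. k \<in> {1..m} \<Longrightarrow> y \<in> {p..q} \<Longrightarrow> \<bar>G k y\<bar> \<le> H"
      by blast
    have "\<exists>L. \<forall>a\<in>{p..q}. \<forall>b\<in>{p..q}. \<bar>G k a - G k b\<bar> \<le> L * \<bar>a - b\<bar>" if "k \<in> {1..m}" for k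
      using Cn_on_1_lipschitz[OF G1[OF that] pq(1)] by metis
    then obtain L where L: "\<And>k a b. k \<in> {1..m} \<Longrightarrow> a \<in> {p..q} \<Longrightarrow> b \<in> {p..q} \<Longrightarrow> \<bar>G k a - G k b\<bar> \<le> L k * \<bar>a - b\<bar>"
      by metis
    let ?S = "{ks. set ks \<subseteq> {1..m} \<and> length ks = Suc m}"
    have itc: "continuous_on {p..q} (iterated_lie_deriv G ks)" if ks_S: "ks \<in> ?S" for ks
    proof -
      obtain k ks' where ks: "ks = k # ks'" using ks_S by (cases ks) auto
      have "Cn_on (m - length ks') D (foldl (\<lambda>f k. lie_deriv (G k) f) (G k) ks')"
        by (rule Cn_on_foldl_lie_deriv[OF D(1), of "{1..m}"]) (use ks_S ks GC in auto)
      then show ?thesis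
        using ks_S ks pq(1) by (auto simp: iterated_lie_deriv_def intro: continuous_on_subset)
    qed
    have "\<exists>B\<ge>0. \<forall>ks\<in>?S. \<forall>y\<in>{p..q}. \<bar>iterated_lie_deriv G ks y\<bar> \<le> B"
      by (rule uniform_bound_on_Icc[OF finite_lists_length_eq[OF finite_atLeastAtMost] itc])
    then obtain B where B: "B \<ge> 0" "\<And>ks y. ks \<in> ?S \<Longrightarrow> y \<in> {p..q} \<Longrightarrow> \<bar>iterated_lie_deriv G ks y\<bar> \<le> B"
      by blast
    \<comment> \<open>Composition with this 1-Lipschitz projection makes the fields globally bounded
      and Lipschitz, as Picard iteration requires.\<close>
    define clip where "clip y = max p (min q y)" for y
    have clip: "clip y \<in> {p..q}" "\<bar>clip y - clip z\<bar> \<le> \<bar>y - z\<bar>" for y z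
      using pq(2) by (auto simp: clip_def)
    define h where "h k y = G k (clip y)" for k y
    define L' where "L' = (\<Sum>k=1..m. \<bar>L k\<bar>)"
    have h_lip: "\<bar>h k y - h k z\<bar> \<le> L' * \<bar>y - z\<bar>" if k: "k \<in> {1..m}" for k y z
    proof -
      have "\<bar>h k y - h k z\<bar> \<le> L k * \<bar>clip y - clip z\<bar>" unfolding h_def by (rule L[OF k clip(1) clip(1)])
      also have "\<dots> \<le> L' * \<bar>y - z\<bar>"
      proof (rule mult_mono)
        have "\<bar>L k\<bar> \<le> L'" unfolding L'_def by (rule member_le_sum) (use k in auto)
        then show "L k \<le> L'" "L' \<ge> 0" by linarith+
      qed (use clip in auto)
      finally show ?thesis .
    qed
    have h_bd: "\<bar>h k y\<bar> \<le> H" if "k \<in> {1..m}" for k y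
      unfolding h_def using H(2)[OF that clip(1)] .
    \<comment> \<open>The decay rate: one period shrinks the error by
      \<open>1 - \<epsilon> * a\<close>, which is at most
      \<open>exp (- (\<epsilon> * a))\<close>.\<close>
    define a where "a = c * \<beta>1"
    have a: "a > 0" using assms by (simp add: a_def)
    \<comment> \<open>With \<kappa> as defined below, \<open>M * \<kappa>\<close> bounds the
      displacement within one period and \<open>C * \<kappa> * \<epsilon>\<close> the Chen-Fliess
      remainder.\<close>
    define M where "M = real m * V * H"
    define C where "C = B * (real m * V) ^ Suc m"
    have MC: "M \<ge> 0" "C \<ge> 0" using V H(1) B(1) by (simp_all add: M_def C_def)
    show "\<exists>c>0. \<exists>r>0. \<forall>\<rho>\<in>{0<..<\<delta>}. \<exists>\<epsilon>'>0. \<forall>\<epsilon>\<in>{0<..\<epsilon>'}. \<forall>x0\<in>ball xs \<delta>.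
          \<exists>x. caratheodory_solution (\<lambda>t x. \<Sum>k=1..m. g k (J x) * dither m v \<epsilon> k t) D {0..} x \<and> x 0 = x0 \<and>
              (\<forall>T y. caratheodory_solution (\<lambda>t x. \<Sum>k=1..m. g k (J x) * dither m v \<epsilon> k t) D {0..<T} y \<and> y 0 = x0 \<longrightarrow> (\<forall>t\<in>{0..<T}. y t = x t)) \<and>
              (\<forall>t\<ge>0. \<bar>x t - xs\<bar> \<le> c * \<bar>x0 - xs\<bar> * exp (- r * t) + \<rho>)"
    \<comment> \<open>The factor \<open>exp a\<close> pays for the delay between \<open>t\<close>
      and the preceding sample time, which is at most \<open>\<epsilon> \<le> 1\<close>. Neither
      witness depends on \<rho>.\<close>
    proof (rule exI[of _ "exp a"], rule conjI[OF exp_gt_zero], rule exI[of _ a], rule conjI[OF a], rule ballI)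
      fix \<rho> assume "\<rho> \<in> {0<..<\<delta>}"
      then have \<rho>: "\<rho> > 0" "\<rho> < \<delta>" by auto
      \<comment> \<open>A threshold for \<kappa> meeting three demands: remainder at most
        \<open>a * \<rho> / 4\<close> per unit of time, displacement at most
        \<open>\<rho> / 2\<close>, and displacement at most \<eta>. The summands 1 prevent division
        by zero.\<close>
      define \<tau> where "\<tau> = min (a * \<rho> / (4 * (C + 1))) (min (\<rho> / (2 * (M + 1))) (\<eta> / (M + 1)))"
      have \<tau>: "\<tau> > 0" using a \<rho> MC \<eta> by (simp add: \<tau>_def)
      have \<tau>C: "C * \<kappa> \<le> a * \<rho> / 4" and \<tau>M: "M * \<kappa> \<le> \<rho> / 2" "M * \<kappa> \<le> \<eta>" if "0 \<le> \<kappa>" "\<kappa> \<le> \<tau>" for \<kappa>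
      proof -
        have *: "b * \<kappa> \<le> d" if "b \<ge> 0" "\<tau> \<le> d / (b + 1)" for b d
        proof -
          have "\<kappa> \<le> d / (b + 1)" using that \<open>\<kappa> \<le> \<tau>\<close> by linarith
          then have "\<kappa> * (b + 1) \<le> d" using that(1) by (simp add: field_simps)
          then show ?thesis using \<open>0 \<le> \<kappa>\<close> by (simp add: algebra_simps)
        qed
        show "C * \<kappa> \<le> a * \<rho> / 4" by (rule *) (use MC in \<open>simp_all add: \<tau>_def\<close>)
        show "M * \<kappa> \<le> \<rho> / 2" by (rule *) (use MC in \<open>simp_all add: \<tau>_def\<close>)
        show "M * \<kappa> \<le> \<eta>" by (rule *) (use MC in \<open>simp_all add: \<tau>_def\<close>)
      qed
      \<comment> \<open>In order, the bounds ensure \<open>\<kappa> \<le> \<tau>\<close>, a sampling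
        delay of at most 1, a nonnegative contraction factor, and no overshooting of the gradient
        step.\<close>
      define \<epsilon>' where "\<epsilon>' = min (\<tau> powr real m) (min 1 (min (1 / a) (1 / (c * \<beta>2))))"
      have "\<epsilon>' > 0" using \<tau> a assms by (simp add: \<epsilon>'_def)
      moreover have "\<exists>x. caratheodory_solution (\<lambda>t x. \<Sum>k=1..m. g k (J x) * dither m v \<epsilon> k t) D {0..} x \<and> x 0 = x0 \<and>
              (\<forall>T y. caratheodory_solution (\<lambda>t x. \<Sum>k=1..m. g k (J x) * dither m v \<epsilon> k t) D {0..<T} y \<and> y 0 = x0 \<longrightarrow> (\<forall>t\<in>{0..<T}. y t = x t)) \<and>
              (\<forall>t\<ge>0. \<bar>x t - xs\<bar> \<le> exp a * \<bar>x0 - xs\<bar> * exp (- a * t) + \<rho>)"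
        if \<epsilon>in: "\<epsilon> \<in> {0<..\<epsilon>'}" and x0: "x0 \<in> ball xs \<delta>" for \<epsilon> x0
      proof -
        have \<epsilon>: "\<epsilon> > 0" "\<epsilon> \<le> 1" "\<epsilon> \<le> \<tau> powr real m" "\<epsilon> \<le> 1 / a" "\<epsilon> \<le> 1 / (c * \<beta>2)"
          using \<epsilon>in by (auto simp: \<epsilon>'_def)
        then have \<epsilon>a: "\<epsilon> * a \<le> 1" and \<epsilon>\<beta>: "\<epsilon> * c * \<beta>2 \<le> 1"
          using a assms(10,18) by (simp_all add: field_simps)
        define \<kappa> where "\<kappa> = \<epsilon> powr (1 / real m)"
        have "\<kappa> \<le> (\<tau> powr real m) powr (1 / real m)"
          unfolding \<kappa>_def using \<epsilon> by (intro powr_mono2) auto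
        then have \<kappa>: "0 \<le> \<kappa>" "\<kappa> \<le> \<tau>" using \<tau> m1 by (simp_all add: \<kappa>_def powr_powr)
        have "\<kappa> ^ m = \<epsilon> powr (1 / real m * real m)"
          unfolding \<kappa>_def using \<epsilon>(1) by (simp only: powr_powr[symmetric]) (simp add: powr_realpow)
        then have \<kappa>m: "\<kappa> ^ m = \<epsilon>" using \<epsilon>(1) m1 by simp
        define u where "u = dither m w \<epsilon>"
        define U where "U = \<epsilon> powr (1 / real m - 1) * V"
        \<comment> \<open>Amplitude times period is of order \<kappa>; as
          \<open>\<kappa> ^ m = \<epsilon>\<close>, the power \<open>m + 1\<close> in the remainder
          becomes a multiple of \<open>\<kappa> * \<epsilon>\<close>.\<close>
        have U\<epsilon>: "U * \<epsilon> = V * \<kappa>"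
          using \<epsilon>(1) by (simp add: U_def \<kappa>_def powr_diff)
        have u_measurable_lebesgue: "u k \<in> borel_measurable lebesgue" if "k \<in> {1..m}" for k
        proof -
          have "(\<lambda>t. w k ((1 / \<epsilon>) *\<^sub>R t)) \<in> borel_measurable lebesgue"
            by (rule measurable_compose[OF lebesgue_measurable_scaling w_measurable[OF that]])
          then show ?thesis by (simp add: u_def dither_def[abs_def])
        qed
        have u_bd: "\<bar>u k t\<bar> \<le> U" for k t
          using w_bound[of k "t / \<epsilon>"] by (simp add: u_def U_def dither_def abs_mult mult_left_mono)
        have u_per: "u k (t + \<epsilon>) = u k t" if "k \<in> {1..m}" for k t
          using w_per[OF that, of "t / \<epsilon>"] \<epsilon>(1) by (simp add: u_def dither_def add_divide_distrib)
        \<comment> \<open>The dither runs on the time \<open>t / \<epsilon>\<close>, so its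
          exceptional set is \<open>N\<close> scaled by \<epsilon>.\<close>
        have u_eq: "dither m v \<epsilon> k t = u k t" if "k \<in> {1..m}" "t \<notin> (\<lambda>t. \<epsilon> * t) ` N" for k t
        proof -
          have "t / \<epsilon> \<notin> N"
          proof
            assume "t / \<epsilon> \<in> N"
            then have "\<epsilon> * (t / \<epsilon>) \<in> (\<lambda>t. \<epsilon> * t) ` N" by (rule imageI)
            then show False using that(2) \<epsilon>(1) by simp
          qed
          then show ?thesis using w_eq[OF that(1)] by (simp add: u_def dither_def)
        qed
        have N\<epsilon>: "negligible ((\<lambda>t. \<epsilon> * t) ` N)" by (rule negligible_times_image[OF N(1)])
        interpret bounded_input "{1..m}" u U
          by unfold_locales (use u_measurable_lebesgue u_bd in auto)
        have sol_iff: "caratheodory_solution (\<lambda>t x. \<Sum>k=1..m. g k (J x) * dither m v \<epsilon> k t) D I' y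
            \<longleftrightarrow> caratheodory_solution (velocity G) D I' y" for I' y
        proof (rule caratheodory_solution_cong_AE)
          have "AE t in lebesgue. t \<notin> (\<lambda>t. \<epsilon> * t) ` N"
            using N\<epsilon> unfolding negligible_iff_null_sets by (rule AE_not_in)
          then show "AE t in lebesgue. \<forall>y. (\<Sum>k=1..m. g k (J y) * dither m v \<epsilon> k t) = velocity G t y"
            by eventually_elim (auto intro!: sum.cong simp: velocity_def G_def u_eq simp del: One_nat_def)
        qed
        obtain x where fi: "\<And>t. t \<ge> 0 \<Longrightarrow> (\<lambda>s. velocity h s (x s)) integrable_on {0..t}"
          and eq: "\<And>t. t \<ge> 0 \<Longrightarrow> x t = x0 + integral {0..t} (\<lambda>s. velocity h s (x s))"
          using picard_existence[of h L' H x0] h_lip h_bd by blast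
        have x_0: "x 0 = x0" using eq[of 0] by simp
        define z where "z n = x (real n * \<epsilon>)" for n
        have speed: "real m * (U * H) * \<epsilon> = M * \<kappa>"
        proof -
          have "real m * (U * H) * \<epsilon> = real m * H * (U * \<epsilon>)" by simp
          then show ?thesis unfolding U\<epsilon> M_def by simp
        qed
        have start: "p + real m * (U * H) * \<epsilon> \<le> x (real n * \<epsilon>)" "x (real n * \<epsilon>) \<le> q - real m * (U * H) * \<epsilon>"
          if "\<bar>z n - xs\<bar> < \<delta>" for n
          unfolding speed using \<tau>M(2)[OF \<kappa>] that by (simp_all add: z_def p_def q_def abs_less_iff)
        have B': "\<bar>iterated_lie_deriv G ks y\<bar> \<le> B"
          if "set ks \<subseteq> {1..m}" "length ks = Suc m" "y \<in> {p..q}" for ks y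
          by (rule B(2)) (use that in auto)
        note pm = clipped_period_map[OF bounded_input_axioms D(1) pq GC m1 H(2) B' B(1) less_imp_le[OF \<epsilon>(1)] u_per
            fi[unfolded h_def clip_def] eq[unfolded h_def clip_def] start]
        have period: "\<bar>x (real n * \<epsilon> + t) - z n\<bar> \<le> M * \<kappa>"
          if "\<bar>z n - xs\<bar> < \<delta>" "t \<in> {0..\<epsilon>}" for n t
          unfolding z_def speed[symmetric] by (rule pm(1); (assumption | rule that))
        have period': "\<bar>z (Suc n) - z n - chen_fliess_sum m G u (z n) \<epsilon>\<bar> \<le> C * \<kappa> * \<epsilon>"
          if "\<bar>z n - xs\<bar> < \<delta>" for n
        proof -
          have "\<bar>x (real n * \<epsilon> + \<epsilon>) - x (real n * \<epsilon>) - chen_fliess_sum m G u (x (real n * \<epsilon>)) \<epsilon>\<bar> \<le> B * (real m * U * \<epsilon>) ^ Suc m"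
            by (rule pm(2); (assumption | rule that))
          moreover have "B * (real m * U * \<epsilon>) ^ Suc m = C * \<kappa> * \<epsilon>"
          proof -
            have "real m * U * \<epsilon> = real m * V * \<kappa>" using U\<epsilon> by simp
            then show ?thesis by (simp only: C_def power_mult_distrib power_Suc \<kappa>m) simp
          qed
          moreover have "z (Suc n) = x (real n * \<epsilon> + \<epsilon>)" by (simp add: z_def algebra_simps)
          ultimately show ?thesis unfolding z_def by (simp only:)
        qed
        \<comment> \<open>The remainder is written as \<open>\<epsilon> * a\<close> times
          \<open>\<rho> / 4\<close>, so that \<open>\<rho> / 4\<close> is the fixed point of the
          affine recursion.\<close>
        have step: "\<bar>z (Suc n) - xs\<bar> \<le> (1 - \<epsilon> * a) * \<bar>z n - xs\<bar> + \<epsilon> * a * (\<rho> / 4)"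
          if zn: "\<bar>z n - xs\<bar> < \<delta>" for n
        proof -
          have zD: "z n \<in> D" using zn \<eta> by (intro subsetD[OF \<eta>(2)]) (auto simp: abs_less_iff)
          \<comment> \<open>The excitation condition concerns \<open>v\<close>, the remainder
            estimate the truncated \<open>w\<close>; their Chen-Fliess sums coincide.\<close>
          have "chen_fliess_sum m G u (z n) \<epsilon> = chen_fliess_sum m G (dither m v \<epsilon>) (z n) \<epsilon>"
            by (rule chen_fliess_sum_cong_AE[OF N\<epsilon> u_eq u_measurable_lebesgue u_bd, symmetric])
          also have "\<dots> = - (\<epsilon> * c) * dJ (z n)"
            unfolding G_def using assms(23)[OF \<epsilon>(1) zD] assms(19)[OF zD] by (simp add: dJ_def)
          finally have "\<bar>z (Suc n) - z n + \<epsilon> * c * dJ (z n)\<bar> \<le> C * \<kappa> * \<epsilon>"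
            using period'[OF zn] by simp
          moreover have "C * \<kappa> * \<epsilon> \<le> a * \<rho> / 4 * \<epsilon>"
            using \<tau>C[OF \<kappa>] \<epsilon>(1) by (intro mult_right_mono) auto
          moreover have "\<bar>(z n - xs) - \<epsilon> * c * dJ (z n)\<bar> \<le> (1 - \<epsilon> * c * \<beta>1) * \<bar>z n - xs\<bar>"
            using assms(13)[OF zD] assms(14)[OF zD] \<epsilon>(1) assms(18) \<epsilon>\<beta>
            by (intro gradient_step_contraction[where ?\<beta>2.0 = \<beta>2]) (auto simp: dJ_def)
          ultimately show ?thesis by (simp add: a_def algebra_simps)
        qed
        have z_bound: "\<bar>z n - xs\<bar> < \<delta> \<and> \<bar>z n - xs\<bar> \<le> (1 - \<epsilon> * a) ^ n * \<bar>z 0 - xs\<bar> + \<rho> / 4" for n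
          by (rule perturbed_contraction[where s = "\<epsilon> * a"])
             (use \<epsilon> \<epsilon>a a \<rho> x0 x_0 step in \<open>auto simp: z_def dist_real_def abs_minus_commute\<close>)
        \<comment> \<open>The index \<open>n\<close> is the number of completed periods, so
          \<open>t\<close> lies in the window that begins at \<open>n * \<epsilon>\<close>; the
          bound on \<open>t\<close> feeds the comparison of exponentials.\<close>
        have window: "\<exists>n. \<bar>x t - z n\<bar> \<le> M * \<kappa> \<and> t \<le> real n * \<epsilon> + \<epsilon>" if "t \<ge> 0" for t
        proof -
          define n where "n = nat \<lfloor>t / \<epsilon>\<rfloor>"
          have "real n \<le> t / \<epsilon>" "t / \<epsilon> \<le> real n + 1"
            using that \<epsilon>(1) by (simp_all add: n_def of_nat_floor)
          then have n: "real n * \<epsilon> \<le> t" "t \<le> real n * \<epsilon> + \<epsilon>" using \<epsilon>(1) by (simp_all add: field_simps)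
          then have "\<bar>x (real n * \<epsilon> + (t - real n * \<epsilon>)) - z n\<bar> \<le> M * \<kappa>"
            using z_bound by (intro period) auto
          then show ?thesis using n(2) by auto
        qed
        have x_range: "x t \<in> {p..q}" if t: "t \<ge> 0" for t
        proof -
          obtain n where n: "\<bar>x t - z n\<bar> \<le> M * \<kappa>" using window[OF t] by blast
          have "\<bar>z n - xs\<bar> < \<delta>" using z_bound by blast
          then show ?thesis using n \<tau>M(2)[OF \<kappa>] unfolding p_def q_def atLeastAtMost_iff by linarith
        qed
        have vel: "velocity h t (x t) = velocity G t (x t)" if "t \<ge> 0" for t
        proof -
          have "clip (x t) = x t" using x_range[OF that] by (auto simp: clip_def)
          then show ?thesis unfolding velocity_def h_def by simp
        qed
        have sol: "caratheodory_solution (velocity G) D {0..} x"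
        proof (rule integral_equation_imp_caratheodory)
          show "(\<lambda>s. velocity G s (x s)) integrable_on {0..t}" if "t \<ge> 0" for t
            by (rule integrable_eq[OF fi[OF that]]) (use vel in auto)
          show "x t = x0 + integral {0..t} (\<lambda>s. velocity G s (x s))" if "t \<ge> 0" for t
          proof -
            have "integral {0..t} (\<lambda>s. velocity h s (x s)) = integral {0..t} (\<lambda>s. velocity G s (x s))"
              by (rule integral_cong) (use vel in auto)
            then show ?thesis using eq[OF that] by simp
          qed
          show "\<bar>velocity G t (x t)\<bar> \<le> real (card {1..m}) * (U * H)" if "t \<ge> 0" for t
            by (rule velocity_bound) (use H(2) x_range[OF that] in blast)
          show "x t \<in> D" if "t \<ge> 0" for t using x_range[OF that] pq(1) by blast
        qed
        moreover have "y t = x t" if y: "caratheodory_solution (velocity G) D {0..<T} y" "y 0 = x0" and t: "t \<in> {0..<T}" for T y t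
          by (rule caratheodory_unique[OF D(2) G1 y(1) sol]) (use y(2) x_0 t in auto)
        moreover have "\<bar>x t - xs\<bar> \<le> exp a * \<bar>x0 - xs\<bar> * exp (- a * t) + \<rho>" if t: "t \<ge> 0" for t
        proof -
          obtain n where n: "\<bar>x t - z n\<bar> \<le> M * \<kappa>" "t \<le> real n * \<epsilon> + \<epsilon>" using window[OF t] by blast
          have "(1 - \<epsilon> * a) ^ n \<le> exp (- (\<epsilon> * a)) ^ n"
            using exp_ge_add_one_self[of "- (\<epsilon> * a)"] \<epsilon>a by (intro power_mono) auto
          also have "\<dots> = exp (- a * (real n * \<epsilon>))" by (simp add: exp_of_nat_mult[symmetric] mult_ac)
          also have "\<dots> \<le> exp (a + - a * t)"
          proof -
            have "a * t \<le> a * (real n * \<epsilon> + 1)" using n(2) \<epsilon>(2) a by (intro mult_left_mono) auto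
            then show ?thesis by (simp add: algebra_simps)
          qed
          finally have "(1 - \<epsilon> * a) ^ n * \<bar>x0 - xs\<bar> \<le> exp a * exp (- a * t) * \<bar>x0 - xs\<bar>"
            unfolding exp_add by (rule mult_right_mono) simp
          then have "\<bar>z n - xs\<bar> \<le> exp a * \<bar>x0 - xs\<bar> * exp (- a * t) + \<rho> / 4"
            using z_bound[of n] x_0 by (simp add: z_def mult_ac)
          \<comment> \<open>The error totals \<open>\<rho> / 4\<close> at the sample and
            \<open>\<rho> / 2\<close> within the period, below \<rho>.\<close>
          then show ?thesis using n(1) \<tau>M(1)[OF \<kappa>] \<rho>(1) by linarith
        qed
        ultimately show ?thesis unfolding sol_iff using x_0 by blast
      qed
      ultimately show "\<exists>\<epsilon>'>0. \<forall>\<epsilon>\<in>{0<..\<epsilon>'}. \<forall>x0\<in>ball xs \<delta>.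
          \<exists>x. caratheodory_solution (\<lambda>t x. \<Sum>k=1..m. g k (J x) * dither m v \<epsilon> k t) D {0..} x \<and> x 0 = x0 \<and>
              (\<forall>T y. caratheodory_solution (\<lambda>t x. \<Sum>k=1..m. g k (J x) * dither m v \<epsilon> k t) D {0..<T} y \<and> y 0 = x0 \<longrightarrow> (\<forall>t\<in>{0..<T}. y t = x t)) \<and>
              (\<forall>t\<ge>0. \<bar>x t - xs\<bar> \<le> exp a * \<bar>x0 - xs\<bar> * exp (- a * t) + \<rho>)"
        by blast
    qed
  qed
qed

end
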